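(* Let $\mathcal{G}(\mathbf{g},\mathbf{b})=\{g_{k,l}=M_{lb_k}g_k\}_{k,l\in\mathbb{Z}}$ be a nonstationary Gabor (NSG) system which is a Bessel sequence in $L^2(\mathbb{R})$ with bound $B$, and let $\mathcal{G}(\mathbf{h},\mathbf{b})=\{h_{k,l}=M_{lb_k}h_k\}_{k,l\in\mathbb{Z}}$ be an NSG system, with the same frequency-shift parameters, which is a frame for $L^2(\mathbb{R})$ with lower and upper frame bounds $A_h$ and $B_h$, respectively. Set $\psi_k=h_k-g_k$ and define, for $k,l\in\mathbb{Z}$, $$\gamma^1_{k,l}=S_{h,h}^{-1}h_{k,l}\ \text{(the canonical dual of } h_{k,l}),\qquad \gamma^2_{k,l}=S_{h,h}^{-1}g_{k,l}.$$ Then the following hold. (i) $\|I-S_{g,\gamma^1}\|\le A_h^{-1/2}\|C_\psi\|$. If $\operatorname{ess\,sup}\sum_{l\in\mathbb{Z}}G^{\psi,\psi}_l<A_h$, then $\{\gamma^1_{k,l}\}_{k,l\in\mathbb{Z}}$ and $\mathcal{G}(\mathbf{g},\mathbf{b})$ are approximately dual frames. (ii) $\|I-S_{g,\gamma^2}\|\le A_h^{-1}(\sqrt{B_h}+\sqrt{B})\,\|C_\psi\|$. If $\operatorname{ess\,sup}\sum_{l\in\mathbb{Z}}G^{\psi,\psi}_l<\dfrac{A_h^2}{(\sqrt{B_h}+\sqrt{B})^2}$, then $\{\gamma^2_{k,l}\}_{k,l\in\mathbb{Z}}$ and $\mathcal{G}(\mathbf{g},\mathbf{b})$ are approximately dual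 frames.
   Context: Modulation: $M_{\omega}g(t)=e^{2\pi i\omega t}g(t)$. The Wiener space $W(L^\infty,\ell^1)$ consists of all $g\in L^\infty(\mathbb{R})$ with $\sum_{k\in\mathbb{Z}}\operatorname{ess\,sup}_{t\in[0,1]}|g(t+k)|<\infty$. A nonstationary Gabor (NSG) system $\mathcal{G}(\mathbf{g},\mathbf{b})$ is given by windows $\mathbf{g}=\{g_k\in W(L^\infty,\ell^1):k\in\mathbb{Z}\}$ and frequency-shift parameters $\mathbf{b}=\{b_k:k\in\mathbb{Z}\}$ as the set $\{g_{k,l}=M_{lb_k}g_k:k,l\in\mathbb{Z}\}$. Standing assumption: $b_k\in[b_L,b_U]\subset\mathbb{R}^+=(0,\infty)$ for all $k$. A family $\{f_i\}$ in $L^2(\mathbb{R})$ is a Bessel sequence with bound $B$ if $\sum_i|\langle f,f_i\rangle|^2\le B\|f\|_2^2$ for all $f\in L^2(\mathbb{R})$; it is a frame with bounds $0<A\le B<\infty$ if moreover $A\|f\|_2^2\le\sum_i|\langle f,f_i\rangle|^2$ for all $f$. For a family $\{g_{k,l}\}$ the analysis operator is $(C_gf)_{k,l}=\langle f,g_{k,l}\rangle$ and the synthesis operator is $U_gc=\sum_{k,l}c_{k,l}g_{k,l}$, $c\in\ell^2$; in particular $C_\psi$ is the analysis operator of $\{M_{lb_k}\psi_k\}_{k,l\in\mathbb{Z}}$. For families $\{g_{k,l}\}$, $\{\gamma_{k,l}\}$ (the latter not necessarily of NSG form), $S_{g,\gamma}=U_\gamma C_g$, i.e. $S_{g,\gamma}f=\sum_{k,l\in\mathbb{Z}}\langle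 f,g_{k,l}\rangle\gamma_{k,l}$; $S_{h,h}$ is the frame operator of $\{h_{k,l}\}$. $\|\cdot\|$ denotes operator norm. $G^{\psi,\psi}_l(t)=\sum_{k\in\mathbb{Z}}b_k^{-1}|\psi_k(t-lb_k^{-1})|\,|\psi_k(t)|$ for $l\in\mathbb{Z}$. Two Bessel sequences $\{g_{k,l}\}$ and $\{\gamma_{k,l}\}$ are called approximately dual frames if $\|I-S_{g,\gamma}\|<1$ or $\|I-S_{\gamma,g}\|<1$. *)

theory Defs
  imports "HOL-Probability.Essential_Supremum"
begin

section \<open>The Hilbert space of square-integrable complex functions on the real line\<close>

definition sq_integrable :: "(real \<Rightarrow> complex) \<Rightarrow> bool" where
  "sq_integrable f \<longleftrightarrow>
     f \<in> borel_measurable lebesgue \<and> integrable lebesgue (\<lambda>t. (cmod (f t))\<^sup>2)"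

lemma sq_integrable_zero [simp]: "sq_integrable (\<lambda>t. 0)"
  by (simp add: sq_integrable_def)

lemma sq_integrable_scale:
  assumes "sq_integrable f"
  shows "sq_integrable (\<lambda>t. c * f t)"
  using assms by (auto simp: sq_integrable_def norm_mult power_mult_distrib)

lemma sq_integrable_add:
  assumes "sq_integrable f" "sq_integrable g"
  shows "sq_integrable (\<lambda>t. f t + g t)"
proof -
  have m [measurable]: "f \<in> borel_measurable lebesgue" "g \<in> borel_measurable lebesgue"
    using assms by (auto simp: sq_integrable_def)
  have "integrable lebesgue (\<lambda>t. (cmod (f t + g t))\<^sup>2)"
  proof (rule Bochner_Integration.integrable_bound)
    show "integrable lebesgue (\<lambda>t. 2 * (cmod (f t))\<^sup>2 + 2 * (cmod (g t))\<^sup>2)"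
      using assms by (auto simp: sq_integrable_def)
    have "(cmod (z + w))\<^sup>2 \<le> 2 * (cmod z)\<^sup>2 + 2 * (cmod w)\<^sup>2" for z w
    proof -
      have "(cmod (z + w))\<^sup>2 \<le> (cmod z + cmod w)\<^sup>2"
        by (simp add: norm_triangle_ineq power_mono)
      also have "\<dots> \<le> 2 * (cmod z)\<^sup>2 + 2 * (cmod w)\<^sup>2"
        using zero_le_power2 [of "cmod z - cmod w"] by (simp add: power2_eq_square algebra_simps)
      finally show ?thesis .
    qed
    then show "AE t in lebesgue. norm ((cmod (f t + g t))\<^sup>2)
        \<le> norm (2 * (cmod (f t))\<^sup>2 + 2 * (cmod (g t))\<^sup>2)"
      by (simp add: abs_of_nonneg)
  qed measurable
  then show ?thesis by (simp add: sq_integrable_def)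
qed

lemma integrable_mult_cnj:
  assumes "sq_integrable f" "sq_integrable g"
  shows "integrable lebesgue (\<lambda>t. f t * cnj (g t))"
proof (rule Bochner_Integration.integrable_bound)
  show "integrable lebesgue (\<lambda>t. (cmod (f t))\<^sup>2 + (cmod (g t))\<^sup>2)"
    using assms by (auto simp: sq_integrable_def)
  have [measurable]: "f \<in> borel_measurable lebesgue" "g \<in> borel_measurable lebesgue"
    using assms by (auto simp: sq_integrable_def)
  have [measurable]: "(\<lambda>t. cnj (g t)) \<in> borel_measurable lebesgue"
    using borel_measurable_continuous_onI [OF continuous_on_cnj [OF continuous_on_id]]
    by (rule measurable_compose [rotated]) simp
  show "(\<lambda>t. f t * cnj (g t)) \<in> borel_measurable lebesgue"
    by measurable
  have "cmod z * cmod w \<le> (cmod z)\<^sup>2 + (cmod w)\<^sup>2" for z w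
  proof -
    have "0 \<le> (cmod z - cmod w)\<^sup>2" "0 \<le> cmod z * cmod w" by auto
    then show ?thesis unfolding power2_diff by linarith
  qed
  then show "AE t in lebesgue. norm (f t * cnj (g t)) \<le> norm ((cmod (f t))\<^sup>2 + (cmod (g t))\<^sup>2)"
    by (simp add: norm_mult)
qed

quotient_type L2 = "real \<Rightarrow> complex" / partial:
  "\<lambda>f g. sq_integrable f \<and> sq_integrable g \<and> (AE t in lebesgue. f t = g t)"
proof (rule part_equivpI)
  show "\<exists>f. sq_integrable f \<and> sq_integrable f \<and> (AE t in lebesgue. f t = f t)"
    by (rule exI [of _ "\<lambda>t. 0"]) simp
  show "symp (\<lambda>f g. sq_integrable f \<and> sq_integrable g \<and> (AE t in lebesgue. f t = g t))"
    by (auto simp: symp_def elim: eventually_mono)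
  show "transp (\<lambda>f g. sq_integrable f \<and> sq_integrable g \<and> (AE t in lebesgue. f t = g t))"
    by (auto simp: transp_def elim: eventually_elim2)
qed

lift_definition scaleC_L2 :: "complex \<Rightarrow> L2 \<Rightarrow> L2" (infixr \<open>*\<^sub>C\<close> 75) is "\<lambda>c f t. c * f t"
  by (auto intro: sq_integrable_scale elim: eventually_mono)

lift_definition cinner_L2 :: "L2 \<Rightarrow> L2 \<Rightarrow> complex"
  is "\<lambda>f g. integral\<^sup>L lebesgue (\<lambda>t. f t * cnj (g t))"
proof -
  fix f f' g g' :: "real \<Rightarrow> complex"
  assume a: "sq_integrable f \<and> sq_integrable f' \<and> (AE t in lebesgue. f t = f' t)"
    and b: "sq_integrable g \<and> sq_integrable g' \<and> (AE t in lebesgue. g t = g' t)"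
  have "AE t in lebesgue. f t * cnj (g t) = f' t * cnj (g' t)"
    using a b by (auto elim: eventually_elim2)
  then show "integral\<^sup>L lebesgue (\<lambda>t. f t * cnj (g t)) = integral\<^sup>L lebesgue (\<lambda>t. f' t * cnj (g' t))"
    using a b by (intro integral_cong_AE borel_measurable_integrable integrable_mult_cnj) auto
qed

instantiation L2 :: real_vector
begin

lift_definition zero_L2 :: L2 is "\<lambda>t. 0" by simp

lift_definition plus_L2 :: "L2 \<Rightarrow> L2 \<Rightarrow> L2" is "\<lambda>f g t. f t + g t"
  by (auto intro: sq_integrable_add elim: eventually_elim2)

lift_definition uminus_L2 :: "L2 \<Rightarrow> L2" is "\<lambda>f t. - f t"
  using sq_integrable_scale [of _ "-1"] by (auto elim: eventually_mono)

definition minus_L2 :: "L2 \<Rightarrow> L2 \<Rightarrow> L2" where "minus_L2 f g = f + (- g)"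

lift_definition scaleR_L2 :: "real \<Rightarrow> L2 \<Rightarrow> L2" is "\<lambda>r f t. complex_of_real r * f t"
  by (auto intro: sq_integrable_scale elim: eventually_mono)

instance
proof
  fix a b c :: L2 and x y :: real
  show "a + b + c = a + (b + c)"
    by transfer (auto intro!: sq_integrable_add simp: add.assoc)
  show "a + b = b + a"
    by transfer (auto intro!: sq_integrable_add simp: add.commute)
  show "0 + a = a"
    by transfer auto
  show "- a + a = 0"
    by transfer auto
  show "a - b = a + - b"
    by (simp add: minus_L2_def)
  show "x *\<^sub>R (a + b) = x *\<^sub>R a + x *\<^sub>R b"
    by transfer (auto intro!: sq_integrable_add sq_integrable_scale simp: distrib_left)
  show "(x + y) *\<^sub>R a = x *\<^sub>R a + y *\<^sub>R a"
    by transfer (auto intro!: sq_integrable_add sq_integrable_scale simp: distrib_right)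
  show "x *\<^sub>R y *\<^sub>R a = (x * y) *\<^sub>R a"
    by transfer (auto intro!: sq_integrable_scale simp: mult.assoc simp flip: of_real_mult)
  show "1 *\<^sub>R a = a"
    by transfer auto
qed

end

instantiation L2 :: real_inner
begin

definition inner_L2 :: "L2 \<Rightarrow> L2 \<Rightarrow> real" where "inner_L2 f g = Re (cinner_L2 f g)"
definition norm_L2 :: "L2 \<Rightarrow> real" where "norm_L2 f = sqrt (inner f f)"
definition sgn_L2 :: "L2 \<Rightarrow> L2" where "sgn_L2 f = inverse (norm f) *\<^sub>R f"
definition dist_L2 :: "L2 \<Rightarrow> L2 \<Rightarrow> real" where "dist_L2 f g = norm (f - g)"
definition uniformity_L2 :: "(L2 \<times> L2) filter" where
  "uniformity_L2 = (INF e\<in>{0<..}. principal {(x, y). dist x y < e})"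
definition open_L2 :: "L2 set \<Rightarrow> bool" where
  "open_L2 U \<longleftrightarrow> (\<forall>x\<in>U. \<forall>\<^sub>F (x', y) in uniformity. x' = x \<longrightarrow> y \<in> U)"

instance
proof
  fix f g h :: L2 and r :: real and U :: "L2 set"
  show "sgn f = inverse (norm f) *\<^sub>R f" by (simp add: sgn_L2_def)
  show "dist f g = norm (f - g)" by (simp add: dist_L2_def)
  show "(uniformity :: (L2 \<times> L2) filter) = (INF e\<in>{0<..}. principal {(x, y). dist x y < e})"
    by (simp add: uniformity_L2_def)
  show "open U \<longleftrightarrow> (\<forall>x\<in>U. \<forall>\<^sub>F (x', y) in uniformity. x' = x \<longrightarrow> y \<in> U)"
    by (simp add: open_L2_def)
  show "norm f = sqrt (inner f f)" by (simp add: norm_L2_def)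
  have Re_int: "Re (integral\<^sup>L lebesgue (\<lambda>t. F t * cnj (G t)))
      = integral\<^sup>L lebesgue (\<lambda>t. Re (F t * cnj (G t)))"
    if "sq_integrable F" "sq_integrable G" for F G
    by (rule integral_Re [OF integrable_mult_cnj [OF that], symmetric])
  have Re_sym: "Re (z * cnj w) = Re (w * cnj z)" for z w
    by simp
  show "inner f g = inner g f"
    unfolding inner_L2_def
    by transfer (simp only: Re_int Re_sym)
  show "inner (f + g) h = inner f h + inner g h"
    unfolding inner_L2_def
    by transfer (auto simp: distrib_right integrable_mult_cnj simp del: times_complex.simps)
  show "inner (r *\<^sub>R f) g = r * inner f g"
    unfolding inner_L2_def by transfer (simp add: mult.assoc)
  have sq: "Re (z * cnj z) = (cmod z)\<^sup>2" for z
    by (metis Re_complex_of_real complex_norm_square of_real_power)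
  have self: "Re (integral\<^sup>L lebesgue (\<lambda>t. F t * cnj (F t)))
      = integral\<^sup>L lebesgue (\<lambda>t. (cmod (F t))\<^sup>2)"
    if "sq_integrable F" for F
    using Re_int [OF that that] by (simp only: sq)
  show "0 \<le> inner f f"
    unfolding inner_L2_def by transfer (simp add: self)
  show "inner f f = 0 \<longleftrightarrow> f = 0"
    unfolding inner_L2_def
    by transfer (auto simp: self sq_integrable_def integral_nonneg_eq_0_iff_AE)
qed

end


section \<open>Frames and their operators\<close>

definition bessel_sequence :: "('i \<Rightarrow> L2) \<Rightarrow> real \<Rightarrow> bool" where
  "bessel_sequence F B \<longleftrightarrow> (\<forall>f.
     (\<lambda>i. (cmod (cinner_L2 f (F i)))\<^sup>2) summable_on UNIV \<and>
     (\<Sum>\<^sub>\<infinity>i. (cmod (cinner_L2 f (F i)))\<^sup>2) \<le> B * (norm f)\<^sup>2)"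

definition frame :: "('i \<Rightarrow> L2) \<Rightarrow> real \<Rightarrow> real \<Rightarrow> bool" where
  "frame F A B \<longleftrightarrow> 0 < A \<and> A \<le> B \<and> bessel_sequence F B \<and>
     (\<forall>f. A * (norm f)\<^sup>2 \<le> (\<Sum>\<^sub>\<infinity>i. (cmod (cinner_L2 f (F i)))\<^sup>2))"

definition analysis :: "('i \<Rightarrow> L2) \<Rightarrow> L2 \<Rightarrow> 'i \<Rightarrow> complex" where
  "analysis F f = (\<lambda>i. cinner_L2 f (F i))"

definition synthesis :: "('i \<Rightarrow> L2) \<Rightarrow> ('i \<Rightarrow> complex) \<Rightarrow> L2" where
  "synthesis F c = (\<Sum>\<^sub>\<infinity>i. c i *\<^sub>C F i)"

text \<open>The operator \<open>S\<^bsub>F,G\<^esub> = U\<^sub>G C\<^sub>F\<close>: analysis with the first family, synthesis with the second.\<close>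

definition mixed_op :: "('i \<Rightarrow> L2) \<Rightarrow> ('i \<Rightarrow> L2) \<Rightarrow> L2 \<Rightarrow> L2" where
  "mixed_op F G = synthesis G \<circ> analysis F"

definition ell2_norm :: "('i \<Rightarrow> complex) \<Rightarrow> real" where
  "ell2_norm c = sqrt (\<Sum>\<^sub>\<infinity>i. (cmod (c i))\<^sup>2)"

text \<open>The norm of the analysis operator into \<open>\<ell>\<^sup>2\<close>; this is \<^const>\<open>onorm\<close> with
  \<^const>\<open>ell2_norm\<close> on the codomain. It is meaningful when the family is a Bessel sequence.\<close>

definition analysis_onorm :: "('i \<Rightarrow> L2) \<Rightarrow> real" where
  "analysis_onorm F = (SUP f. ell2_norm (analysis F f) / norm f)"

definition approx_dual_frames :: "('i \<Rightarrow> L2) \<Rightarrow> ('i \<Rightarrow> L2) \<Rightarrow> bool" where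
  "approx_dual_frames F G \<longleftrightarrow>
     (\<exists>B. bessel_sequence F B) \<and> (\<exists>B. bessel_sequence G B) \<and>
     (onorm (\<lambda>f. f - mixed_op F G f) < 1 \<or> onorm (\<lambda>f. f - mixed_op G F f) < 1)"


section \<open>Nonstationary Gabor systems\<close>

definition modulation :: "real \<Rightarrow> (real \<Rightarrow> complex) \<Rightarrow> real \<Rightarrow> complex" where
  "modulation \<omega> g t = exp (2 * of_real pi * \<i> * of_real \<omega> * of_real t) * g t"

definition wiener_space :: "(real \<Rightarrow> complex) set" where
  "wiener_space = {g. g \<in> borel_measurable lebesgue \<and>
     esssup lebesgue (\<lambda>t. ennreal (cmod (g t))) < \<infinity> \<and>
     (\<Sum>\<^sub>\<infinity>k::int. esssup (lebesgue_on {0..1}) (\<lambda>t. ennreal (cmod (g (t + of_int k))))) < \<infinity>}"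

definition nsg_system :: "(int \<Rightarrow> real \<Rightarrow> complex) \<Rightarrow> (int \<Rightarrow> real) \<Rightarrow> bool" where
  "nsg_system g b \<longleftrightarrow> (\<forall>k. g k \<in> wiener_space) \<and> (\<exists>bL bU. 0 < bL \<and> (\<forall>k. b k \<in> {bL..bU}))"

text \<open>Windows in \<^const>\<open>wiener_space\<close> are square-integrable, so \<^const>\<open>abs_L2\<close> is only used
  inside its domain when \<^const>\<open>nsg_system\<close> holds.\<close>

definition nsg_family :: "(int \<Rightarrow> real \<Rightarrow> complex) \<Rightarrow> (int \<Rightarrow> real) \<Rightarrow> int \<times> int \<Rightarrow> L2" where
  "nsg_family g b = (\<lambda>(k, l). abs_L2 (modulation (of_int l * b k) (g k)))"

definition G_corr :: "(int \<Rightarrow> real \<Rightarrow> complex) \<Rightarrow> (int \<Rightarrow> real) \<Rightarrow> int \<Rightarrow> real \<Rightarrow> ennreal" where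
  "G_corr \<psi> b l t =
     (\<Sum>\<^sub>\<infinity>k. ennreal (inverse (b k) * cmod (\<psi> k (t - of_int l * inverse (b k))) * cmod (\<psi> k t)))"

end

theory Submission
  imports Defs
begin

text \<open>
  Since \<open>S\<^bsub>h,h\<^esub>\<inverse>\<close> intertwines synthesis with \<open>h\<close> and with its canonical dual, \<open>I - S\<^bsub>g,\<gamma>1\<^esub>\<close> is the
  synthesis operator of the canonical dual (a Bessel sequence with bound \<open>1 / A\<^sub>h\<close>) applied to
  \<open>C\<^sub>\<psi>\<close>, and \<open>I - S\<^bsub>g,\<gamma>2\<^esub> = S\<^bsub>h,h\<^esub>\<inverse> (U\<^sub>h C\<^sub>\<psi> + U\<^sub>\<psi> C\<^sub>g)\<close> with \<open>\<parallel>S\<^bsub>h,h\<^esub>\<inverse>\<parallel> \<le> 1 / A\<^sub>h\<close>. The remaining estimate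
  \<open>\<parallel>C\<^sub>\<psi>\<parallel>\<^sup>2 \<le> ess sup \<Sum>\<^sub>l G\<^sub>l\<close> comes from Bessel's inequality for the exponentials on one period of
  length \<open>1 / b\<^sub>k\<close>, followed by AM-GM on the products \<open>\<bar>f(t) f(t - j / b\<^sub>k)\<bar>\<close>.
\<close>

section \<open>The Hilbert space structure of \<^typ>\<open>L2\<close>\<close>

text \<open>The operator estimates hold for any frame and any Bessel family over the same index
  type; the Gabor structure enters only through a Bessel bound for the difference family. Real
  suprema and infinite sums carry no information when they diverge, so that family is first shown to
  be Bessel with a crude constant, which makes \<open>analysis_onorm\<close> a genuine operator
  norm. Periodizations are estimated in \<open>ennreal\<close>, where every sum exists and may be
  exchanged with the integral. The exponent in (i) explains the separate treatment of the canonical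
  dual: the norm of the inverse frame operator alone would give it the Bessel bound B_h / A_h^2,
  whereas the quadratic form of the inverse gives 1 / A_h. Each threshold is the value below which
  the squared norm of the analysis operator pushes the corresponding operator bound under 1.\<close>

lemma sq_integrable_rep_L2: "sq_integrable (rep_L2 f)"
  using Quotient3_rep_reflp [OF Quotient3_L2] by auto

lemma abs_rep_L2: "abs_L2 (rep_L2 f) = f"
  by (rule Quotient3_abs_rep [OF Quotient3_L2])

lemma plus_abs_L2:
  "sq_integrable f \<Longrightarrow> sq_integrable g \<Longrightarrow> abs_L2 f + abs_L2 g = abs_L2 (\<lambda>t. f t + g t)"
  by (rule plus_L2.abs_eq) auto

lemma uminus_abs_L2: "sq_integrable f \<Longrightarrow> - abs_L2 f = abs_L2 (\<lambda>t. - f t)"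
  by (rule uminus_L2.abs_eq) auto

lemma sq_integrable_uminus: "sq_integrable f \<Longrightarrow> sq_integrable (\<lambda>t. - f t)"
  using sq_integrable_scale [of f "-1"] by simp

lemma sq_integrable_diff:
  "sq_integrable f \<Longrightarrow> sq_integrable g \<Longrightarrow> sq_integrable (\<lambda>t. f t - g t)"
  using sq_integrable_add [of f "\<lambda>t. - g t"] by (simp add: sq_integrable_uminus)

lemma minus_abs_L2:
  "sq_integrable f \<Longrightarrow> sq_integrable g \<Longrightarrow> abs_L2 f - abs_L2 g = abs_L2 (\<lambda>t. f t - g t)"
  by (simp add: minus_L2_def uminus_abs_L2 plus_abs_L2 sq_integrable_uminus)

lemma scaleC_abs_L2: "sq_integrable f \<Longrightarrow> c *\<^sub>C abs_L2 f = abs_L2 (\<lambda>t. c * f t)"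
  by (rule scaleC_L2.abs_eq) auto

lemma scaleR_abs_L2: "sq_integrable f \<Longrightarrow> r *\<^sub>R abs_L2 f = abs_L2 (\<lambda>t. complex_of_real r * f t)"
  by (rule scaleR_L2.abs_eq) auto

lemma cinner_abs_L2:
  "sq_integrable f \<Longrightarrow> sq_integrable g \<Longrightarrow>
     cinner_L2 (abs_L2 f) (abs_L2 g) = integral\<^sup>L lebesgue (\<lambda>t. f t * cnj (g t))"
  by (rule cinner_L2.abs_eq) auto

lemma L2_cases:
  obtains F where "sq_integrable F" "f = abs_L2 F"
  using sq_integrable_rep_L2 abs_rep_L2 by metis

lemma scaleR_L2_eq_scaleC: "r *\<^sub>R (f :: L2) = complex_of_real r *\<^sub>C f"
  by (cases f rule: L2_cases) (simp add: scaleR_abs_L2 scaleC_abs_L2)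

lemma scaleC_add_right_L2: "c *\<^sub>C (f + g) = c *\<^sub>C f + c *\<^sub>C g"
proof -
  obtain F G where "sq_integrable F" "f = abs_L2 F" "sq_integrable G" "g = abs_L2 G"
    using L2_cases by metis
  then show ?thesis
    by (simp add: plus_abs_L2 scaleC_abs_L2 sq_integrable_add sq_integrable_scale algebra_simps)
qed

lemma scaleC_diff_left_L2: "(c - d) *\<^sub>C f = c *\<^sub>C f - d *\<^sub>C f"
  by (cases f rule: L2_cases)
    (simp add: minus_abs_L2 scaleC_abs_L2 sq_integrable_scale algebra_simps)

lemma scaleC_diff_right_L2: "c *\<^sub>C (f - g) = c *\<^sub>C f - c *\<^sub>C g"
  by (metis scaleC_add_right_L2 add_diff_cancel_right' diff_add_cancel)

lemma scaleC_scaleC_L2: "c *\<^sub>C d *\<^sub>C f = (c * d) *\<^sub>C f"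
  by (cases f rule: L2_cases) (simp add: scaleC_abs_L2 sq_integrable_scale algebra_simps)

lemma cinner_add_left_L2: "cinner_L2 (f + g) h = cinner_L2 f h + cinner_L2 g h"
proof -
  obtain F G H where "sq_integrable F" "f = abs_L2 F" "sq_integrable G" "g = abs_L2 G"
    "sq_integrable H" "h = abs_L2 H"
    using L2_cases by metis
  then show ?thesis
    by (simp add: plus_abs_L2 cinner_abs_L2 sq_integrable_add distrib_right integrable_mult_cnj)
qed

lemma cinner_scaleC_left_L2: "cinner_L2 (c *\<^sub>C f) g = c * cinner_L2 f g"
proof -
  obtain F G where "sq_integrable F" "f = abs_L2 F" "sq_integrable G" "g = abs_L2 G"
    using L2_cases by metis
  then show ?thesis
    by (simp add: scaleC_abs_L2 cinner_abs_L2 sq_integrable_scale mult.assoc)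
qed

lemma cinner_commute_L2: "cinner_L2 g f = cnj (cinner_L2 f g)"
proof -
  obtain F G where "sq_integrable F" "f = abs_L2 F" "sq_integrable G" "g = abs_L2 G"
    using L2_cases by metis
  then show ?thesis
    using Bochner_Integration.integral_cnj [of lebesgue "\<lambda>t. F t * cnj (G t)"]
    by (simp add: cinner_abs_L2 mult.commute)
qed

lemma cinner_add_right_L2: "cinner_L2 h (f + g) = cinner_L2 h f + cinner_L2 h g"
  by (metis cinner_commute_L2 cinner_add_left_L2 complex_cnj_add)

lemma cinner_scaleC_right_L2: "cinner_L2 g (c *\<^sub>C f) = cnj c * cinner_L2 g f"
  by (metis cinner_commute_L2 cinner_scaleC_left_L2 complex_cnj_mult)

lemma cinner_diff_left_L2: "cinner_L2 (f - g) h = cinner_L2 f h - cinner_L2 g h"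
  by (metis cinner_add_left_L2 add_diff_cancel_right' diff_add_cancel)

lemma cinner_diff_right_L2: "cinner_L2 h (f - g) = cinner_L2 h f - cinner_L2 h g"
  by (metis cinner_add_right_L2 add_diff_cancel_right' diff_add_cancel)

lemma cinner_zero_left_L2 [simp]: "cinner_L2 0 f = 0"
  using cinner_add_left_L2 [of 0 0 f] by simp

lemma Re_cinner_L2: "Re (cinner_L2 f g) = inner f g"
  by (simp add: inner_L2_def)

lemma cinner_self_L2: "cinner_L2 f f = complex_of_real ((norm f)\<^sup>2)"
proof -
  have "cnj (cinner_L2 f f) = cinner_L2 f f"
    by (metis cinner_commute_L2)
  then have "cinner_L2 f f = complex_of_real (Re (cinner_L2 f f))"
    by (simp add: complex_eq_iff)
  then show ?thesis
    by (simp only: Re_cinner_L2 power2_norm_eq_inner)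
qed

lemma norm_scaleC_L2: "norm (c *\<^sub>C f) = cmod c * norm (f :: L2)"
proof -
  have "complex_of_real ((norm (c *\<^sub>C f))\<^sup>2) = complex_of_real ((cmod c * norm f)\<^sup>2)"
    unfolding cinner_self_L2 [symmetric] cinner_scaleC_left_L2 cinner_scaleC_right_L2
    by (simp add: cinner_self_L2 power_mult_distrib mult_ac flip: complex_norm_square)
  then have "(norm (c *\<^sub>C f))\<^sup>2 = (cmod c * norm f)\<^sup>2"
    using of_real_eq_iff by blast
  then show ?thesis
    by (simp add: power2_eq_iff_nonneg)
qed

lemma bounded_linear_scaleC_L2: "bounded_linear (\<lambda>f. c *\<^sub>C f)"
  by (rule bounded_linear_intro [where K = "cmod c"])
    (simp_all add: scaleC_add_right_L2 scaleR_L2_eq_scaleC scaleC_scaleC_L2 norm_scaleC_L2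
      mult.commute)

lemma norm_cinner_le_L2: "cmod (cinner_L2 f g) \<le> norm f * norm g"
proof -
  \<comment> \<open>A phase that rotates the inner product onto the nonnegative real axis, where the
    real Cauchy-Schwarz inequality applies; it is 0 if the product vanishes.\<close>
  define c where "c = cnj (sgn (cinner_L2 f g))"
  have "cmod (cinner_L2 f g) = Re (cinner_L2 (c *\<^sub>C f) g)"
    by (cases "cinner_L2 f g = 0")
      (auto simp: cinner_scaleC_left_L2 c_def sgn_div_norm scaleR_conv_of_real field_simps
        complex_norm_square [symmetric] power2_eq_square simp flip: of_real_mult)
  also have "\<dots> \<le> norm (c *\<^sub>C f) * norm g"
    unfolding Re_cinner_L2 by (rule norm_cauchy_schwarz)
  also have "\<dots> \<le> norm f * norm g"
    by (auto simp: norm_scaleC_L2 c_def norm_sgn intro!: mult_right_mono)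
  finally show ?thesis .
qed

lemma bounded_linear_cinner_left_L2: "bounded_linear (\<lambda>f. cinner_L2 f g)"
  by (rule bounded_linear_intro [where K = "norm g"])
    (auto simp: cinner_add_left_L2 scaleR_L2_eq_scaleC cinner_scaleC_left_L2 scaleR_conv_of_real
      norm_cinner_le_L2)

lemma cinner_sum_left_L2: "cinner_L2 (sum f J) g = (\<Sum>i\<in>J. cinner_L2 (f i) g)"
  by (rule linear_sum) (rule bounded_linear.linear [OF bounded_linear_cinner_left_L2])

text \<open>The passage from the quotient to nonnegative integrals, where Fatou and Tonelli apply
  without integrability conditions.\<close>

lemma ennreal_norm_abs_L2:
  assumes "sq_integrable f"
  shows "ennreal ((norm (abs_L2 f))\<^sup>2) = (\<integral>\<^sup>+t. ennreal ((cmod (f t))\<^sup>2) \<partial>lebesgue)"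
proof -
  have "complex_of_real ((norm (abs_L2 f))\<^sup>2) = integral\<^sup>L lebesgue (\<lambda>t. complex_of_real ((cmod (f t))\<^sup>2))"
    unfolding cinner_self_L2 [symmetric]
    by (simp add: cinner_abs_L2 [OF assms assms] flip: complex_norm_square)
  also have "\<dots> = complex_of_real (integral\<^sup>L lebesgue (\<lambda>t. (cmod (f t))\<^sup>2))"
    by (rule integral_complex_of_real)
  finally have "(norm (abs_L2 f))\<^sup>2 = integral\<^sup>L lebesgue (\<lambda>t. (cmod (f t))\<^sup>2)"
    using of_real_eq_iff by blast
  then show ?thesis
    using assms by (simp add: nn_integral_eq_integral sq_integrable_def)
qed

text \<open>Needed to read \<open>0 \<le> B\<close> off a Bessel inequality: on the zero space every
  real number would be a bound.\<close>

lemma L2_nontrivial: "\<exists>f :: L2. f \<noteq> 0"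
proof -
  let ?f = "indicator {0..1::real} :: real \<Rightarrow> complex"
  have e: "(cmod (?f t))\<^sup>2 = indicator {0..1} t" for t
    by (simp add: indicator_def)
  have sq: "sq_integrable ?f"
    unfolding sq_integrable_def e by (intro conjI borel_measurable_indicator integrable_real_indicator) auto
  have "(\<integral>\<^sup>+t. ennreal ((cmod (?f t))\<^sup>2) \<partial>lebesgue) = 1"
    unfolding e by (simp add: ennreal_indicator)
  then have "norm (abs_L2 ?f) \<noteq> 0"
    using ennreal_norm_abs_L2 [OF sq] by auto
  then show ?thesis
    by auto
qed

section \<open>Completeness\<close>

lemma Cauchy_fast_subseq:
  fixes X :: "nat \<Rightarrow> 'a :: real_normed_vector"
  assumes "Cauchy X"
  obtains r where "strict_mono r" "\<And>n. norm (X (r (Suc n)) - X (r n)) < (1 / 2) ^ n"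
proof -
  have "\<exists>M. \<forall>m\<ge>M. \<forall>k\<ge>M. norm (X m - X k) < (1 / 2) ^ n" for n
    using CauchyD [OF assms, of "(1 / 2) ^ n"] by simp
  then obtain N where N: "\<And>n m k. m \<ge> N n \<Longrightarrow> k \<ge> N n \<Longrightarrow> norm (X m - X k) < (1 / 2) ^ n"
    by metis
  \<comment> \<open>The sum keeps \<open>r n\<close> above the threshold \<open>N n\<close>, and the
    extra \<open>n\<close> makes \<open>r\<close> strictly increasing.\<close>
  define r where "r n = n + (\<Sum>i\<le>n. N i)" for n
  have "strict_mono r"
    by (simp add: strict_mono_Suc_iff r_def)
  moreover have "norm (X (r (Suc n)) - X (r n)) < (1 / 2) ^ n" for n
  proof (rule N)
    show "N n \<le> r n"
      unfolding r_def by (rule trans_le_add2) (rule member_le_sum, auto)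
    then show "N n \<le> r (Suc n)"
      by (simp add: r_def)
  qed
  ultimately show thesis
    by (rule that)
qed

text \<open>The L2 norm controls integrals of squares, not of absolute values. The weight
  \<open>2 ^ n\<close> pays for the change: \<open>x \<le> 2 ^ n * x\<^sup>2 + 1 / 2 ^ n\<close>, so
  the increments are absolutely summable.\<close>

lemma convergent_of_summable_weighted_increments:
  fixes u :: "nat \<Rightarrow> 'a :: banach"
  assumes "summable (\<lambda>n. 2 ^ n * (norm (u (Suc n) - u n))\<^sup>2)"
  shows "convergent u"
proof -
  have amgm: "x \<le> a * x\<^sup>2 + 1 / a" if "0 \<le> x" "0 < a" for a x :: real
  proof -
    have "0 \<le> (a * x - 1)\<^sup>2"
      by (rule zero_le_power2)
    also have "\<dots> = (a * x)\<^sup>2 + 1 - 2 * (a * x)"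
      by (simp add: power2_diff)
    finally have "a * x \<le> (a * x)\<^sup>2 + 1"
      using mult_nonneg_nonneg [of a x] that by linarith
    then show ?thesis
      using that by (simp add: field_simps power2_eq_square)
  qed
  have "summable (\<lambda>n. u (Suc n) - u n)"
  proof (rule summable_comparison_test')
    show "summable (\<lambda>n. 2 ^ n * (norm (u (Suc n) - u n))\<^sup>2 + 1 / 2 ^ n)"
      using assms summable_geometric [of "1 / 2 :: real"]
      by (intro summable_add) (simp_all add: power_one_over)
    show "norm (u (Suc n) - u n) \<le> 2 ^ n * (norm (u (Suc n) - u n))\<^sup>2 + 1 / 2 ^ n" for n
      by (rule amgm) simp_all
  qed
  then have "convergent (\<lambda>n. u n - u 0)"
    by (simp only: summable_iff_convergent sum_lessThan_telescope)
  from convergent_add [OF this convergent_const [of "u 0"]] show ?thesis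
    by simp
qed

text \<open>The Riesz-Fischer theorem. Completeness makes synthesis series converge and Banach's
  fixed point theorem applicable to the frame operator.\<close>

instance L2 :: complete_space
proof
  fix X :: "nat \<Rightarrow> L2"
  assume X: "Cauchy X"
  define F where "F n = rep_L2 (X n)" for n
  have sq: "sq_integrable (F n)" and X_eq: "X n = abs_L2 (F n)" for n
    by (simp_all add: F_def sq_integrable_rep_L2 abs_rep_L2)
  have [measurable]: "F n \<in> borel_measurable lebesgue" for n
    using sq by (simp add: sq_integrable_def)
  have norm_diff: "(\<integral>\<^sup>+t. ennreal ((cmod (F m t - F n t))\<^sup>2) \<partial>lebesgue)
      = ennreal ((norm (X m - X n))\<^sup>2)" for m n
    by (simp add: X_eq minus_abs_L2 sq sq_integrable_diff ennreal_norm_abs_L2)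
  obtain r where r: "strict_mono r" and
    fast: "\<And>n. norm (X (r (Suc n)) - X (r n)) < (1 / 2) ^ n"
    using Cauchy_fast_subseq [OF X] by blast
  have "(\<integral>\<^sup>+t. (\<Sum>n. ennreal (2 ^ n * (cmod (F (r (Suc n)) t - F (r n) t))\<^sup>2)) \<partial>lebesgue)
      = (\<Sum>n. ennreal (2 ^ n * (norm (X (r (Suc n)) - X (r n)))\<^sup>2))"
    by (simp add: nn_integral_suminf nn_integral_cmult norm_diff ennreal_mult)
  also have "\<dots> \<le> (\<Sum>n. ennreal ((1 / 2) ^ n))"
  proof (intro suminf_le ennreal_leI allI)
    fix n
    have "(norm (X (r (Suc n)) - X (r n)))\<^sup>2 \<le> ((1 / 2) ^ n)\<^sup>2"
      using fast [of n] by (intro power_mono) auto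
    then have "2 ^ n * (norm (X (r (Suc n)) - X (r n)))\<^sup>2 \<le> 2 ^ n * ((1 / 2) ^ n)\<^sup>2"
      by (intro mult_left_mono) auto
    then show "2 ^ n * (norm (X (r (Suc n)) - X (r n)))\<^sup>2 \<le> (1 / 2) ^ n"
      by (simp add: power2_eq_square power_one_over)
  qed auto
  also have "\<dots> = ennreal (\<Sum>n. (1 / 2) ^ n)"
    by (intro suminf_ennreal2) auto
  finally have "(\<integral>\<^sup>+t. (\<Sum>n. ennreal (2 ^ n * (cmod (F (r (Suc n)) t - F (r n) t))\<^sup>2)) \<partial>lebesgue) \<noteq> \<infinity>"
    by (auto simp: top_unique)
  then have "AE t in lebesgue. (\<Sum>n. ennreal (2 ^ n * (cmod (F (r (Suc n)) t - F (r n) t))\<^sup>2)) \<noteq> \<infinity>"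
    by (intro nn_integral_PInf_AE) auto
  then have conv: "AE t in lebesgue. convergent (\<lambda>n. F (r n) t)"
  proof eventually_elim
    case (elim t)
    then have "summable (\<lambda>n. 2 ^ n * (cmod (F (r (Suc n)) t - F (r n) t))\<^sup>2)"
      by (intro summable_suminf_not_top) auto
    then show ?case
      by (rule convergent_of_summable_weighted_increments)
  qed
  \<comment> \<open>Off a null set the subsequence converges; elsewhere the value of
    \<open>lim\<close> does not matter.\<close>
  define G where "G t = lim (\<lambda>n. F (r n) t)" for t
  have [measurable]: "G \<in> borel_measurable lebesgue"
    unfolding G_def [abs_def] by measurable
  \<comment> \<open>Fatou's lemma along the subsequence, with \<open>m\<close> fixed, carries the
    Cauchy estimate over to the limit.\<close>
  have tail: "(\<integral>\<^sup>+t. ennreal ((cmod (G t - F m t))\<^sup>2) \<partial>lebesgue) \<le> ennreal (e\<^sup>2)"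
    if e: "\<And>k. k \<ge> M \<Longrightarrow> norm (X k - X m) < e" for e M m
  proof -
    have "AE t in lebesgue. ennreal ((cmod (G t - F m t))\<^sup>2)
        = liminf (\<lambda>n. ennreal ((cmod (F (r n) t - F m t))\<^sup>2))"
      using conv
    proof eventually_elim
      case (elim t)
      then have "(\<lambda>n. F (r n) t) \<longlonglongrightarrow> G t"
        by (simp add: G_def convergent_LIMSEQ_iff)
      then have "(\<lambda>n. ennreal ((cmod (F (r n) t - F m t))\<^sup>2)) \<longlonglongrightarrow> ennreal ((cmod (G t - F m t))\<^sup>2)"
        by (intro tendsto_ennrealI tendsto_intros)
      then show ?case
        by (rule lim_imp_Liminf [OF sequentially_bot, symmetric])
    qed
    then have "(\<integral>\<^sup>+t. ennreal ((cmod (G t - F m t))\<^sup>2) \<partial>lebesgue)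
        = (\<integral>\<^sup>+t. liminf (\<lambda>n. ennreal ((cmod (F (r n) t - F m t))\<^sup>2)) \<partial>lebesgue)"
      by (rule nn_integral_cong_AE)
    also have "\<dots> \<le> liminf (\<lambda>n. \<integral>\<^sup>+t. ennreal ((cmod (F (r n) t - F m t))\<^sup>2) \<partial>lebesgue)"
      by (intro nn_integral_liminf) measurable
    also have "\<dots> \<le> liminf (\<lambda>n::nat. ennreal (e\<^sup>2))"
    proof (intro Liminf_mono eventually_sequentiallyI [of M])
      fix n
      assume "M \<le> n"
      then have "norm (X (r n) - X m) < e"
        using seq_suble [OF r, of n] by (intro e) simp
      then show "(\<integral>\<^sup>+t. ennreal ((cmod (F (r n) t - F m t))\<^sup>2) \<partial>lebesgue) \<le> ennreal (e\<^sup>2)"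
        unfolding norm_diff by (intro ennreal_leI power_mono) auto
    qed
    also have "\<dots> = ennreal (e\<^sup>2)"
      by (simp add: Liminf_const)
    finally show ?thesis .
  qed
  have sqG: "sq_integrable G"
  proof -
    obtain M where "\<And>k. k \<ge> M \<Longrightarrow> norm (X k - X M) < 1"
      using CauchyD [OF X, of 1] by auto
    then have "(\<integral>\<^sup>+t. ennreal ((cmod (G t - F M t))\<^sup>2) \<partial>lebesgue) \<le> ennreal (1\<^sup>2)"
      by (rule tail)
    then have "sq_integrable (\<lambda>t. G t - F M t)"
      unfolding sq_integrable_def by (auto intro!: integrableI_bounded simp: le_less_trans)
    from sq_integrable_add [OF this sq [of M]] show ?thesis
      by simp
  qed
  have "X \<longlonglongrightarrow> abs_L2 G"
  proof (rule LIMSEQ_I)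
    fix e :: real
    assume "0 < e"
    then obtain M where M: "\<And>k m. k \<ge> M \<Longrightarrow> m \<ge> M \<Longrightarrow> norm (X k - X m) < e / 2"
      using CauchyD [OF X, of "e / 2"] by auto
    have "norm (X m - abs_L2 G) < e" if "m \<ge> M" for m
    proof -
      have "ennreal ((norm (abs_L2 G - X m))\<^sup>2) \<le> ennreal ((e / 2)\<^sup>2)"
        unfolding X_eq
        unfolding minus_abs_L2 [OF sqG sq] ennreal_norm_abs_L2 [OF sq_integrable_diff [OF sqG sq]]
        by (rule tail) (rule M [OF _ that])
      then have "(norm (abs_L2 G - X m))\<^sup>2 \<le> (e / 2)\<^sup>2"
        by (subst (asm) ennreal_le_iff) auto
      then have "norm (abs_L2 G - X m) \<le> e / 2"
        using \<open>0 < e\<close> by (auto intro: power2_le_imp_le)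
      then show ?thesis
        using \<open>0 < e\<close> by (simp add: norm_minus_commute)
    qed
    then show "\<exists>no. \<forall>m\<ge>no. norm (X m - abs_L2 G) < e"
      by blast
  qed
  then show "convergent X"
    by (rule convergentI)
qed

instance L2 :: banach ..

section \<open>Bessel sequences and frames\<close>

lemma bessel_sequence_summable:
  "bessel_sequence F B \<Longrightarrow> (\<lambda>i. (cmod (analysis F f i))\<^sup>2) summable_on UNIV"
  by (simp add: bessel_sequence_def analysis_def)

lemma bessel_sequence_bound:
  "bessel_sequence F B \<Longrightarrow> (\<Sum>\<^sub>\<infinity>i. (cmod (analysis F f i))\<^sup>2) \<le> B * (norm f)\<^sup>2"
  by (simp add: bessel_sequence_def analysis_def)

lemma bessel_sequence_nonneg:
  assumes "bessel_sequence F B"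
  shows "0 \<le> B"
proof -
  obtain f :: L2 where "f \<noteq> 0"
    using L2_nontrivial by blast
  have "0 \<le> B * (norm f)\<^sup>2"
    by (rule order_trans [OF infsum_nonneg bessel_sequence_bound [OF assms]]) simp
  with \<open>f \<noteq> 0\<close> show ?thesis
    by (simp add: zero_le_mult_iff)
qed

lemma ell2_norm_power2: "(ell2_norm c)\<^sup>2 = (\<Sum>\<^sub>\<infinity>i. (cmod (c i))\<^sup>2)"
  by (simp add: ell2_norm_def infsum_nonneg)

lemma ell2_norm_nonneg: "0 \<le> ell2_norm c"
  by (simp add: ell2_norm_def infsum_nonneg)

lemma bessel_sequence_ell2_norm:
  assumes "bessel_sequence F B"
  shows "ell2_norm (analysis F f) \<le> sqrt B * norm f"
  using real_sqrt_le_mono [OF bessel_sequence_bound [OF assms, of f]]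
  by (simp add: ell2_norm_def real_sqrt_mult)

text \<open>Bounded partial sums give summability as well as the bound. Both are required, since
  \<open>infsum\<close> of a divergent family is 0 and would satisfy any nonnegative bound.\<close>

lemma bessel_sequenceI:
  assumes "\<And>f J. finite J \<Longrightarrow> (\<Sum>i\<in>J. (cmod (cinner_L2 f (F i)))\<^sup>2) \<le> B * (norm f)\<^sup>2"
  shows "bessel_sequence F B"
  unfolding bessel_sequence_def
proof (intro allI conjI)
  fix f
  show s: "(\<lambda>i. (cmod (cinner_L2 f (F i)))\<^sup>2) summable_on UNIV"
    using assms [of _ f]
    by (intro nonneg_bdd_above_summable_on bdd_aboveI [where M = "B * (norm f)\<^sup>2"]) auto
  show "(\<Sum>\<^sub>\<infinity>i. (cmod (cinner_L2 f (F i)))\<^sup>2) \<le> B * (norm f)\<^sup>2"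
    by (rule infsum_le_finite_sums [OF s assms])
qed

text \<open>Duality: the squared norm of \<open>y = \<Sum>c\<^sub>i F\<^sub>i\<close> is \<open>\<Sum>c\<^sub>i \<langle>F\<^sub>i, y\<rangle>\<close>; AM-GM with the Bessel
  inequality for \<open>y\<close> absorbs half of it.\<close>

lemma bessel_norm_finite_sum:
  assumes F: "bessel_sequence F B" and J: "finite J"
  shows "(norm (\<Sum>i\<in>J. c i *\<^sub>C F i))\<^sup>2 \<le> B * (\<Sum>i\<in>J. (cmod (c i))\<^sup>2)"
proof -
  define y where "y = (\<Sum>i\<in>J. c i *\<^sub>C F i)"
  define d where "d i = cmod (analysis F y i)" for i
  have d: "(\<Sum>i\<in>J. (d i)\<^sup>2) \<le> B * (norm y)\<^sup>2"
    using finite_sum_le_infsum [OF bessel_sequence_summable [OF F] J]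
      bessel_sequence_bound [OF F, of y] unfolding d_def by (meson order_trans zero_le_power2 subset_UNIV)
  have "(norm y)\<^sup>2 = cmod (cinner_L2 y y)"
    unfolding cinner_self_L2 norm_of_real by simp
  also have "cinner_L2 y y = (\<Sum>i\<in>J. c i * cinner_L2 (F i) y)"
    by (subst y_def) (simp add: cinner_sum_left_L2 cinner_scaleC_left_L2)
  also have "cmod \<dots> \<le> (\<Sum>i\<in>J. cmod (c i) * d i)"
    by (rule norm_sum [THEN order_trans])
      (simp add: norm_mult d_def analysis_def cinner_commute_L2 [of "F _" y])
  finally have y: "(norm y)\<^sup>2 \<le> (\<Sum>i\<in>J. cmod (c i) * d i)" .
  show ?thesis
  \<comment> \<open>The AM-GM weight divides by \<open>B\<close>; for \<open>B = 0\<close> the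
    coefficients \<open>d i\<close> vanish on \<open>J\<close> instead.\<close>
  proof (cases "B = 0")
    case True
    with d have "(\<Sum>i\<in>J. (d i)\<^sup>2) = 0"
      by (simp add: antisym sum_nonneg)
    with J have "d i = 0" if "i \<in> J" for i
      using that by (simp add: sum_nonneg_eq_0_iff)
    with y show ?thesis
      by (simp add: True y_def)
  next
    case False
    with bessel_sequence_nonneg [OF F] have B: "0 < B"
      by simp
    have amgm: "cmod (c i) * d i \<le> (B * (cmod (c i))\<^sup>2 + (d i)\<^sup>2 / B) / 2" for i
    proof -
      have "0 \<le> (B * cmod (c i) - d i)\<^sup>2 / B"
        using B by simp
      also have "\<dots> = B * (cmod (c i))\<^sup>2 + (d i)\<^sup>2 / B - 2 * (cmod (c i) * d i)"
        using B by (simp add: field_simps power2_eq_square)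
      finally show ?thesis
        by simp
    qed
    have "(norm y)\<^sup>2 \<le> (\<Sum>i\<in>J. (B * (cmod (c i))\<^sup>2 + (d i)\<^sup>2 / B) / 2)"
      using y sum_mono [OF amgm] by (rule order_trans)
    also have "\<dots> = (B * (\<Sum>i\<in>J. (cmod (c i))\<^sup>2) + (\<Sum>i\<in>J. (d i)\<^sup>2) / B) / 2"
      by (simp add: sum.distrib sum_distrib_left flip: sum_divide_distrib)
    also have "\<dots> \<le> (B * (\<Sum>i\<in>J. (cmod (c i))\<^sup>2) + (norm y)\<^sup>2) / 2"
      using d B by (simp add: field_simps)
    finally show ?thesis
      by (simp add: y_def)
  qed
qed

text \<open>Cauchy criterion for unordered sums: the sums over \<open>F\<close> and over
  \<open>J \<union> F\<close> both lie within \<open>e / 2\<close> of the limit.\<close>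

lemma summable_on_tail:
  fixes f :: "'a \<Rightarrow> real"
  assumes "f summable_on UNIV" "0 < e"
  obtains F where "finite F" "\<And>J. finite J \<Longrightarrow> J \<inter> F = {} \<Longrightarrow> sum f J < e"
proof -
  have "(sum f \<longlongrightarrow> infsum f UNIV) (finite_subsets_at_top UNIV)"
    using has_sum_infsum [OF assms(1)] by (simp add: has_sum_def)
  then have "\<forall>\<^sub>F X in finite_subsets_at_top UNIV. dist (sum f X) (infsum f UNIV) < e / 2"
    using assms(2) by (intro tendstoD) auto
  then obtain F where F: "finite F"
    "\<And>X. finite X \<Longrightarrow> F \<subseteq> X \<Longrightarrow> dist (sum f X) (infsum f UNIV) < e / 2"
    unfolding eventually_finite_subsets_at_top by auto
  have "sum f J < e" if J: "finite J" "J \<inter> F = {}" for J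
  proof -
    have "sum f (J \<union> F) = sum f J + sum f F"
      using J F(1) by (intro sum.union_disjoint) auto
    moreover have "dist (sum f (J \<union> F)) (infsum f UNIV) < e / 2"
      using F(1) J(1) by (intro F(2)) auto
    moreover have "dist (sum f F) (infsum f UNIV) < e / 2"
      using F(1) by (intro F(2)) auto
    ultimately show ?thesis
      unfolding dist_real_def by linarith
  qed
  with F(1) show thesis
    using that by blast
qed

text \<open>The squared norm of a block outside \<open>F0\<close> is at most \<open>B\<close> times
  a tail of the squared coefficients, so the partial sums form a Cauchy filter.\<close>

lemma bessel_synthesis_summable:
  assumes F: "bessel_sequence F B" and c: "(\<lambda>i. (cmod (c i))\<^sup>2) summable_on UNIV"
  shows "(\<lambda>i. c i *\<^sub>C F i) summable_on UNIV"
proof -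
  let ?S = "sum (\<lambda>i. c i *\<^sub>C F i)"
  have "\<exists>P. eventually P (finite_subsets_at_top UNIV) \<and> (\<forall>x y. P x \<and> P y \<longrightarrow> dist (?S x) (?S y) < e)"
    if e: "e > 0" for e
  proof -
    have B: "0 \<le> B"
      using F by (rule bessel_sequence_nonneg)
    \<comment> \<open>Dividing by \<open>B + 1\<close> avoids a zero denominator and yields a strict
      inequality.\<close>
    define \<delta> where "\<delta> = (e / 2)\<^sup>2 / (B + 1)"
    have "\<delta> > 0"
      using B e by (simp add: \<delta>_def)
    then obtain F0 where F0: "finite F0"
      "\<And>J. finite J \<Longrightarrow> J \<inter> F0 = {} \<Longrightarrow> (\<Sum>i\<in>J. (cmod (c i))\<^sup>2) < \<delta>"
      using summable_on_tail [OF c] by blast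
    have small: "dist (?S x) (?S F0) < e / 2" if x: "finite x" "F0 \<subseteq> x" for x
    proof -
      have "(norm (?S (x - F0)))\<^sup>2 \<le> B * (\<Sum>i\<in>x - F0. (cmod (c i))\<^sup>2)"
        using x by (intro bessel_norm_finite_sum F) auto
      also have "\<dots> \<le> B * \<delta>"
        using x B by (intro mult_left_mono less_imp_le [OF F0(2)]) auto
      also have "\<dots> < (B + 1) * \<delta>"
        using \<open>\<delta> > 0\<close> by simp
      also have "\<dots> = (e / 2)\<^sup>2"
        using B by (simp add: \<delta>_def)
      finally have "norm (?S (x - F0)) < e / 2"
        by (rule power2_less_imp_less) (use e in simp)
      then show ?thesis
        using x F0(1) by (simp add: dist_norm sum_diff)
    qed
    show ?thesis
    proof (intro exI [of _ "\<lambda>x. finite x \<and> F0 \<subseteq> x"] conjI allI impI)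
      show "\<forall>\<^sub>F x in finite_subsets_at_top UNIV. finite x \<and> F0 \<subseteq> x"
        using F0(1) by (auto simp: eventually_finite_subsets_at_top)
      fix x y
      assume "(finite x \<and> F0 \<subseteq> x) \<and> (finite y \<and> F0 \<subseteq> y)"
      then have "dist (?S x) (?S F0) < e / 2" "dist (?S y) (?S F0) < e / 2"
        using small by blast+
      then show "dist (?S x) (?S y) < e"
        by (rule dist_triangle_half_l)
    qed
  qed
  then have "cauchy_filter (filtermap ?S (finite_subsets_at_top UNIV))"
    by (simp add: cauchy_filter_metric_filtermap)
  moreover have "complete (UNIV :: L2 set)"
    by (rule complete_UNIV)
  ultimately obtain s where "(?S \<longlongrightarrow> s) (finite_subsets_at_top UNIV)"
    using complete_uniform [where S = "UNIV :: L2 set"] by (force simp: filterlim_def)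
  then show ?thesis
    using summable_on_def has_sum_def by blast
qed

lemma bessel_has_sum_synthesis:
  assumes "bessel_sequence F B" "(\<lambda>i. (cmod (c i))\<^sup>2) summable_on UNIV"
  shows "((\<lambda>i. c i *\<^sub>C F i) has_sum synthesis F c) UNIV"
  unfolding synthesis_def by (rule has_sum_infsum [OF bessel_synthesis_summable [OF assms]])

lemma bessel_norm_synthesis:
  assumes F: "bessel_sequence F B" and c: "(\<lambda>i. (cmod (c i))\<^sup>2) summable_on UNIV"
  shows "norm (synthesis F c) \<le> sqrt B * ell2_norm c"
proof (rule tendsto_upperbound [OF tendsto_norm])
  show "(sum (\<lambda>i. c i *\<^sub>C F i) \<longlongrightarrow> synthesis F c) (finite_subsets_at_top UNIV)"
    using bessel_has_sum_synthesis [OF assms] by (simp add: has_sum_def)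
  show "\<forall>\<^sub>F J in finite_subsets_at_top UNIV. norm (\<Sum>i\<in>J. c i *\<^sub>C F i) \<le> sqrt B * ell2_norm c"
  proof (rule eventually_finite_subsets_at_top_weakI)
    fix J :: "'a set"
    assume J: "finite J"
    have "(norm (\<Sum>i\<in>J. c i *\<^sub>C F i))\<^sup>2 \<le> B * (\<Sum>i\<in>J. (cmod (c i))\<^sup>2)"
      using F J by (rule bessel_norm_finite_sum)
    also have "\<dots> \<le> B * (ell2_norm c)\<^sup>2"
      unfolding ell2_norm_power2 using bessel_sequence_nonneg [OF F]
      by (intro mult_left_mono finite_sum_le_infsum c J) auto
    finally show "norm (\<Sum>i\<in>J. c i *\<^sub>C F i) \<le> sqrt B * ell2_norm c"
      using real_sqrt_le_mono ell2_norm_nonneg [of c] by (fastforce simp: real_sqrt_mult)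
  qed
qed auto

lemma has_sum_minus:
  fixes f g :: "'a \<Rightarrow> 'b :: real_normed_vector"
  assumes "(f has_sum a) A" "(g has_sum b) A"
  shows "((\<lambda>x. f x - g x) has_sum (a - b)) A"
  using has_sum_add [OF assms(1), of "\<lambda>x. - g x" "- b"] assms(2) by (simp add: has_sum_uminus)

lemma synthesis_diff:
  assumes "bessel_sequence F B"
    and "(\<lambda>i. (cmod (c i))\<^sup>2) summable_on UNIV" "(\<lambda>i. (cmod (d i))\<^sup>2) summable_on UNIV"
  shows "synthesis F (\<lambda>i. c i - d i) = synthesis F c - synthesis F d"
  using has_sum_minus [OF bessel_has_sum_synthesis [OF assms(1,2)]
      bessel_has_sum_synthesis [OF assms(1,3)]]
  unfolding synthesis_def by (intro infsumI) (simp add: scaleC_diff_left_L2)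

lemma synthesis_family_diff:
  assumes "bessel_sequence F B" "bessel_sequence G B'"
    and "(\<lambda>i. (cmod (c i))\<^sup>2) summable_on UNIV"
  shows "synthesis (\<lambda>i. F i - G i) c = synthesis F c - synthesis G c"
  using has_sum_minus [OF bessel_has_sum_synthesis [OF assms(1,3)]
      bessel_has_sum_synthesis [OF assms(2,3)]]
  unfolding synthesis_def by (intro infsumI) (simp add: scaleC_diff_right_L2)

lemma synthesis_scaleC:
  assumes "bessel_sequence F B" "(\<lambda>i. (cmod (c i))\<^sup>2) summable_on UNIV"
  shows "synthesis F (\<lambda>i. a * c i) = a *\<^sub>C synthesis F c"
  using has_sum_bounded_linear [OF bounded_linear_scaleC_L2 bessel_has_sum_synthesis [OF assms]]
  unfolding synthesis_def by (intro infsumI) (simp add: scaleC_scaleC_L2)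

text \<open>Continuity moves \<open>T\<close> inside the infinite sum. Complex homogeneity is a
  separate hypothesis because \<open>bounded_linear\<close> expresses only real linearity.\<close>

lemma synthesis_image:
  assumes "bessel_sequence F B" "(\<lambda>i. (cmod (c i))\<^sup>2) summable_on UNIV"
    and "bounded_linear T" "\<And>a f. T (a *\<^sub>C f) = a *\<^sub>C T f"
  shows "synthesis (\<lambda>i. T (F i)) c = T (synthesis F c)"
  using has_sum_bounded_linear [OF assms(3) bessel_has_sum_synthesis [OF assms(1,2)]]
  unfolding synthesis_def by (intro infsumI) (simp add: assms(4))

section \<open>Analysis operators and their norm\<close>

lemma analysis_diff: "analysis F (f - g) = (\<lambda>i. analysis F f i - analysis F g i)"
  by (simp add: analysis_def cinner_diff_left_L2)

lemma analysis_family_diff: "analysis (\<lambda>i. F i - G i) f = (\<lambda>i. analysis F f i - analysis G f i)"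
  by (simp add: analysis_def cinner_diff_right_L2)

lemma analysis_scaleC: "analysis F (a *\<^sub>C f) = (\<lambda>i. a * analysis F f i)"
  by (simp add: analysis_def cinner_scaleC_left_L2)

text \<open>Supplies the upper bound that the real supremum in \<open>analysis_onorm\<close> needs.
  At \<open>f = 0\<close> the quotient is 0 by convention, harmless because
  \<open>0 \<le> B\<close>.\<close>

lemma bessel_analysis_quotient_le:
  assumes "bessel_sequence F B"
  shows "ell2_norm (analysis F f) / norm f \<le> sqrt B"
  using bessel_sequence_ell2_norm [OF assms, of f] bessel_sequence_nonneg [OF assms]
  by (cases "f = 0") (auto simp: field_simps)

lemma bessel_analysis_onorm_upper:
  assumes "bessel_sequence F B"
  shows "analysis_onorm F \<le> sqrt B"
  unfolding analysis_onorm_def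
  by (rule cSUP_least) (simp_all add: bessel_analysis_quotient_le [OF assms])

lemma bessel_analysis_quotient_le_onorm:
  assumes "bessel_sequence F B"
  shows "ell2_norm (analysis F f) / norm f \<le> analysis_onorm F"
  unfolding analysis_onorm_def
  by (rule cSUP_upper) (auto intro!: bdd_aboveI2 bessel_analysis_quotient_le [OF assms])

lemma bessel_analysis_onorm_nonneg:
  assumes "bessel_sequence F B"
  shows "0 \<le> analysis_onorm F"
  using bessel_analysis_quotient_le_onorm [OF assms, of 0] by simp

lemma bessel_analysis_onorm:
  assumes "bessel_sequence F B"
  shows "ell2_norm (analysis F f) \<le> analysis_onorm F * norm f"
  using bessel_analysis_quotient_le_onorm [OF assms, of f]
  by (cases "f = 0") (simp_all add: field_simps ell2_norm_def analysis_def)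

text \<open>Turns the analysis norm into a Bessel bound, hence, by duality, into a bound for the
  synthesis operator.\<close>

lemma bessel_analysis_onorm_bessel:
  assumes "bessel_sequence F B"
  shows "bessel_sequence F ((analysis_onorm F)\<^sup>2)"
proof -
  have "(\<Sum>\<^sub>\<infinity>i. (cmod (analysis F f i))\<^sup>2) \<le> (analysis_onorm F * norm f)\<^sup>2" for f
    unfolding ell2_norm_power2 [symmetric]
    by (intro power_mono bessel_analysis_onorm [OF assms] ell2_norm_nonneg)
  then show ?thesis
    using bessel_sequence_summable [OF assms]
    by (simp add: bessel_sequence_def analysis_def power_mult_distrib)
qed

text \<open>The constant is crude and reaches no final estimate; what counts is that the difference
  family has some Bessel bound, so that its \<open>analysis_onorm\<close> is a finite
  supremum.\<close>

lemma bessel_sequence_diff: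
  assumes F: "bessel_sequence F B" and G: "bessel_sequence G B'"
  shows "bessel_sequence (\<lambda>i. F i - G i) (2 * B + 2 * B')"
proof (rule bessel_sequenceI)
  fix f and J :: "'a set"
  assume J: "finite J"
  have "(cmod (z - w))\<^sup>2 \<le> 2 * (cmod z)\<^sup>2 + 2 * (cmod w)\<^sup>2" for z w
  proof -
    have "(cmod (z - w))\<^sup>2 \<le> (cmod z + cmod w)\<^sup>2"
      by (simp add: norm_triangle_ineq4 power_mono)
    also have "\<dots> \<le> 2 * (cmod z)\<^sup>2 + 2 * (cmod w)\<^sup>2"
      using zero_le_power2 [of "cmod z - cmod w"] by (simp add: power2_eq_square algebra_simps)
    finally show ?thesis .
  qed
  then have "(\<Sum>i\<in>J. (cmod (cinner_L2 f (F i - G i)))\<^sup>2)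
      \<le> (\<Sum>i\<in>J. 2 * (cmod (analysis F f i))\<^sup>2 + 2 * (cmod (analysis G f i))\<^sup>2)"
    by (intro sum_mono) (simp add: cinner_diff_right_L2 analysis_def)
  also have "\<dots> = 2 * (\<Sum>i\<in>J. (cmod (analysis F f i))\<^sup>2) + 2 * (\<Sum>i\<in>J. (cmod (analysis G f i))\<^sup>2)"
    by (simp add: sum.distrib sum_distrib_left)
  also have "\<dots> \<le> 2 * (\<Sum>\<^sub>\<infinity>i. (cmod (analysis F f i))\<^sup>2) + 2 * (\<Sum>\<^sub>\<infinity>i. (cmod (analysis G f i))\<^sup>2)"
    by (intro add_mono mult_left_mono finite_sum_le_infsum J bessel_sequence_summable [OF F]
        bessel_sequence_summable [OF G]) auto
  also have "\<dots> \<le> 2 * (B * (norm f)\<^sup>2) + 2 * (B' * (norm f)\<^sup>2)"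
    by (intro add_mono mult_left_mono bessel_sequence_bound [OF F] bessel_sequence_bound [OF G]) auto
  finally show "(\<Sum>i\<in>J. (cmod (cinner_L2 f (F i - G i)))\<^sup>2) \<le> (2 * B + 2 * B') * (norm f)\<^sup>2"
    by (simp add: algebra_simps)
qed

section \<open>The frame operator as a Hermitian form\<close>

lemma bessel_frame_op_inner:
  assumes "bessel_sequence F B"
  shows "((\<lambda>i. analysis F f i * cnj (analysis F g i)) has_sum cinner_L2 (mixed_op F F f) g) UNIV"
proof -
  have "((\<lambda>i. cinner_L2 (analysis F f i *\<^sub>C F i) g) has_sum cinner_L2 (mixed_op F F f) g) UNIV"
    unfolding mixed_op_def o_def
    by (rule has_sum_bounded_linear [OF bounded_linear_cinner_left_L2 bessel_has_sum_synthesis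
          [OF assms bessel_sequence_summable [OF assms]]])
  then show ?thesis
    by (simp add: cinner_scaleC_left_L2 analysis_def cinner_commute_L2 [of "F _" g])
qed

lemma bessel_frame_op_self:
  assumes "bessel_sequence F B"
  shows "cinner_L2 (mixed_op F F f) f = complex_of_real (\<Sum>\<^sub>\<infinity>i. (cmod (analysis F f i))\<^sup>2)"
proof (rule has_sum_unique [OF bessel_frame_op_inner [OF assms]])
  show "((\<lambda>i. analysis F f i * cnj (analysis F f i)) has_sum
      complex_of_real (\<Sum>\<^sub>\<infinity>i. (cmod (analysis F f i))\<^sup>2)) UNIV"
    using has_sum_of_real [OF has_sum_infsum [OF bessel_sequence_summable [OF assms]]]
    unfolding complex_norm_square [symmetric] .
qed

text \<open>Exchanging \<open>f\<close> and \<open>g\<close> conjugates every term of the series for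
  the form.\<close>

lemma bessel_frame_op_adjoint:
  assumes "bessel_sequence F B"
  shows "cinner_L2 (mixed_op F F f) g = cinner_L2 f (mixed_op F F g)"
proof -
  have "((\<lambda>i. cnj (analysis F g i * cnj (analysis F f i))) has_sum
      cnj (cinner_L2 (mixed_op F F g) f)) UNIV"
    by (rule has_sum_bounded_linear [OF bounded_linear_cnj bessel_frame_op_inner [OF assms]])
  then have "((\<lambda>i. analysis F f i * cnj (analysis F g i)) has_sum cinner_L2 f (mixed_op F F g)) UNIV"
    by (simp add: mult.commute cinner_commute_L2 [of f])
  with bessel_frame_op_inner [OF assms] show ?thesis
    by (rule has_sum_unique)
qed

lemma bessel_mixed_op_diff:
  assumes "bessel_sequence F B" "bessel_sequence G B'"
  shows "mixed_op F G (f - g) = mixed_op F G f - mixed_op F G g"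
  using assms by (simp add: mixed_op_def analysis_diff synthesis_diff bessel_sequence_summable)

lemma bessel_mixed_op_scaleC:
  assumes "bessel_sequence F B" "bessel_sequence G B'"
  shows "mixed_op F G (a *\<^sub>C f) = a *\<^sub>C mixed_op F G f"
  using assms by (simp add: mixed_op_def analysis_scaleC synthesis_scaleC bessel_sequence_summable)

lemma bessel_mixed_op_norm:
  assumes "bessel_sequence F B" "bessel_sequence G B'"
  shows "norm (mixed_op F G f) \<le> sqrt B' * (sqrt B * norm f)"
proof -
  have "norm (mixed_op F G f) \<le> sqrt B' * ell2_norm (analysis F f)"
    unfolding mixed_op_def o_def
    by (rule bessel_norm_synthesis [OF assms(2) bessel_sequence_summable [OF assms(1)]])
  also have "\<dots> \<le> sqrt B' * (sqrt B * norm f)"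
    using bessel_sequence_nonneg [OF assms(2)]
    by (intro mult_left_mono bessel_sequence_ell2_norm assms(1)) auto
  finally show ?thesis .
qed

section \<open>Inverse of the frame operator and the canonical dual\<close>

context
  fixes F :: "'i \<Rightarrow> L2" and A B :: real
  assumes frame: "frame F A B"
begin

lemma frame_bessel: "bessel_sequence F B" and frame_lower_pos: "0 < A"
  and frame_bounds_le: "A \<le> B"
  using frame by (auto simp: frame_def)

text \<open>The form at \<open>f\<close> is the sum of the squared coefficients, so the lower frame
  bound is coercivity. Injectivity, surjectivity and the norm of the inverse all rest on it.\<close>

lemma frame_op_coercive: "A * (norm f)\<^sup>2 \<le> inner (mixed_op F F f) f"
  using frame bessel_frame_op_self [OF frame_bessel, of f]
  by (simp add: frame_def analysis_def inner_L2_def)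

lemma frame_op_norm_lower: "A * norm f \<le> norm (mixed_op F F f)"
proof (cases "f = 0")
  case False
  have "A * (norm f)\<^sup>2 \<le> norm (mixed_op F F f) * norm f"
    using frame_op_coercive [of f] norm_cauchy_schwarz [of "mixed_op F F f" f] by linarith
  with False show ?thesis
    by (simp add: power2_eq_square)
qed simp

lemma frame_op_inj: "inj (mixed_op F F)"
proof (rule injI)
  fix f g
  assume "mixed_op F F f = mixed_op F F g"
  then have "mixed_op F F (f - g) = 0"
    by (simp add: bessel_mixed_op_diff [OF frame_bessel frame_bessel])
  with frame_op_norm_lower [of "f - g"] frame_lower_pos show "f = g"
    by (simp add: mult_le_0_iff)
qed

text \<open>A solution of \<open>S f = y\<close> is a fixed point of \<open>f \<mapsto> f - \<rho> (S f - y)\<close>, which for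
  \<open>\<rho> = A / B\<^sup>2\<close> contracts with factor \<open>sqrt (1 - A\<^sup>2 / B\<^sup>2)\<close>.\<close>

lemma frame_op_surj: "surj (mixed_op F F)"
proof -
  let ?S = "mixed_op F F"
  \<comment> \<open>The minimizer of 1 - 2 \<rho> A + \<rho>^2 B^2, the factor by which the step
    reduces the squared norm; the minimum is 1 - A^2 / B^2.\<close>
  define \<rho> where "\<rho> = A / B\<^sup>2"
  have B: "0 < B"
    using frame_lower_pos frame_bounds_le by linarith
  have \<rho>: "0 < \<rho>"
    using frame_lower_pos B by (simp add: \<rho>_def)
  have q: "0 \<le> 1 - A\<^sup>2 / B\<^sup>2" "1 - A\<^sup>2 / B\<^sup>2 < 1"
    using frame_lower_pos frame_bounds_le B by (auto simp: power_mono)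
  have contr: "norm (f - \<rho> *\<^sub>R ?S f) \<le> sqrt (1 - A\<^sup>2 / B\<^sup>2) * norm f" for f
  proof -
    have "norm (?S f) \<le> B * norm f"
      using bessel_mixed_op_norm [OF frame_bessel frame_bessel, of f] B by (simp add: mult.assoc [symmetric])
    then have "(norm (?S f))\<^sup>2 \<le> (B * norm f)\<^sup>2"
      by (intro power_mono) auto
    then have "\<rho>\<^sup>2 * (norm (?S f))\<^sup>2 \<le> \<rho>\<^sup>2 * (B * norm f)\<^sup>2"
      by (intro mult_left_mono) auto
    moreover have "\<rho> * (A * (norm f)\<^sup>2) \<le> \<rho> * inner (?S f) f"
      using \<rho> by (intro mult_left_mono frame_op_coercive) auto
    moreover have "(norm (f - \<rho> *\<^sub>R ?S f))\<^sup>2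
        = (norm f)\<^sup>2 - 2 * (\<rho> * inner (?S f) f) + \<rho>\<^sup>2 * (norm (?S f))\<^sup>2"
      unfolding power2_norm_eq_inner
      by (simp add: inner_diff_left inner_diff_right inner_commute power2_eq_square algebra_simps)
    ultimately have "(norm (f - \<rho> *\<^sub>R ?S f))\<^sup>2
        \<le> (norm f)\<^sup>2 - 2 * (\<rho> * (A * (norm f)\<^sup>2)) + \<rho>\<^sup>2 * (B * norm f)\<^sup>2"
      by linarith
    also have "\<dots> = (1 - A\<^sup>2 / B\<^sup>2) * (norm f)\<^sup>2"
      using B by (simp add: \<rho>_def field_simps power2_eq_square)
    finally show ?thesis
      using real_sqrt_le_mono by (fastforce simp: real_sqrt_mult)
  qed
  show ?thesis
  proof (rule surjI)
    fix y
    let ?\<Phi> = "\<lambda>f. f - \<rho> *\<^sub>R (?S f - y)"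
    have "\<exists>!f. ?\<Phi> f = f"
    proof (rule banach_fix_type [of "sqrt (1 - A\<^sup>2 / B\<^sup>2)"])
      show "\<forall>f g. dist (?\<Phi> f) (?\<Phi> g) \<le> sqrt (1 - A\<^sup>2 / B\<^sup>2) * dist f g"
      proof (intro allI)
        fix f g
        have "?\<Phi> f - ?\<Phi> g = (f - g) - \<rho> *\<^sub>R ?S (f - g)"
          by (simp add: bessel_mixed_op_diff [OF frame_bessel frame_bessel] algebra_simps)
        then show "dist (?\<Phi> f) (?\<Phi> g) \<le> sqrt (1 - A\<^sup>2 / B\<^sup>2) * dist f g"
          using contr [of "f - g"] by (simp only: dist_norm)
      qed
    qed (use q in auto)
    then have "\<exists>f. ?S f = y"
      using \<rho> by auto
    then show "?S (SOME f. ?S f = y) = y"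
      by (rule someI_ex)
  qed
qed

lemma frame_op_inv: "mixed_op F F (inv (mixed_op F F) f) = f"
  by (rule surj_f_inv_f [OF frame_op_surj])

lemma inv_frame_op: "inv (mixed_op F F) (mixed_op F F f) = f"
  by (rule inv_f_f [OF frame_op_inj])

lemma inv_frame_op_scaleC: "inv (mixed_op F F) (a *\<^sub>C f) = a *\<^sub>C inv (mixed_op F F) f"
  by (rule inv_f_eq [OF frame_op_inj])
    (simp add: bessel_mixed_op_scaleC [OF frame_bessel frame_bessel] frame_op_inv)

lemma inv_frame_op_diff:
  "inv (mixed_op F F) (f - g) = inv (mixed_op F F) f - inv (mixed_op F F) g"
  by (rule inv_f_eq [OF frame_op_inj])
    (simp add: bessel_mixed_op_diff [OF frame_bessel frame_bessel] frame_op_inv)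

lemma inv_frame_op_norm: "norm (inv (mixed_op F F) f) \<le> inverse A * norm f"
  using frame_op_norm_lower [of "inv (mixed_op F F) f"] frame_lower_pos
  by (simp add: frame_op_inv field_simps)

lemma bounded_linear_inv_frame_op: "bounded_linear (inv (mixed_op F F))"
proof (rule bounded_linear_intro)
  fix f g r
  have "inv (mixed_op F F) 0 = 0"
    using inv_frame_op_diff [of 0 0] by simp
  then show "inv (mixed_op F F) (f + g) = inv (mixed_op F F) f + inv (mixed_op F F) g"
    using inv_frame_op_diff [of f "- g"] inv_frame_op_diff [of 0 g] by simp
  show "inv (mixed_op F F) (r *\<^sub>R f) = r *\<^sub>R inv (mixed_op F F) f"
    by (simp add: scaleR_L2_eq_scaleC inv_frame_op_scaleC)
  show "norm (inv (mixed_op F F) f) \<le> norm f * inverse A"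
    using inv_frame_op_norm [of f] by (simp add: mult.commute)
qed

text \<open>Symmetry of the frame operator, applied to the preimages of \<open>f\<close> and
  \<open>g\<close>.\<close>

lemma inv_frame_op_adjoint:
  "cinner_L2 f (inv (mixed_op F F) g) = cinner_L2 (inv (mixed_op F F) f) g"
  using bessel_frame_op_adjoint [OF frame_bessel, of "inv (mixed_op F F) f" "inv (mixed_op F F) g"]
  by (simp add: frame_op_inv)

text \<open>The inverse moves to the other side of the inner product, so the coefficients are those
  of its value at \<open>f\<close> with respect to \<open>G\<close>. Its norm then enters
  squared.\<close>

lemma bessel_inv_frame_op:
  assumes "bessel_sequence G C"
  shows "bessel_sequence (\<lambda>i. inv (mixed_op F F) (G i)) (C * (inverse A)\<^sup>2)"
  unfolding bessel_sequence_def
proof (intro allI conjI)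
  fix f
  let ?T = "inv (mixed_op F F)"
  show "(\<lambda>i. (cmod (cinner_L2 f (?T (G i))))\<^sup>2) summable_on UNIV"
    using bessel_sequence_summable [OF assms, of "?T f"]
    by (simp add: analysis_def inv_frame_op_adjoint)
  have "(\<Sum>\<^sub>\<infinity>i. (cmod (cinner_L2 f (?T (G i))))\<^sup>2) \<le> C * (norm (?T f))\<^sup>2"
    using bessel_sequence_bound [OF assms, of "?T f"]
    by (simp add: analysis_def inv_frame_op_adjoint)
  also have "\<dots> \<le> C * (inverse A * norm f)\<^sup>2"
    using bessel_sequence_nonneg [OF assms] by (intro mult_left_mono power_mono inv_frame_op_norm) auto
  finally show "(\<Sum>\<^sub>\<infinity>i. (cmod (cinner_L2 f (?T (G i))))\<^sup>2) \<le> C * (inverse A)\<^sup>2 * (norm f)\<^sup>2"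
    by (simp add: power_mult_distrib mult.assoc)
qed

text \<open>With S the frame operator and x the preimage of f, the sum of squared coefficients is
  the form of S at x, that is the inner product of f and x, so the norm of the inverse enters only
  once. The square root of this bound is the factor in (i).\<close>

lemma bessel_canonical_dual: "bessel_sequence (\<lambda>i. inv (mixed_op F F) (F i)) (inverse A)"
  unfolding bessel_sequence_def
proof (intro allI conjI)
  fix f
  let ?T = "inv (mixed_op F F)"
  \<comment> \<open>The weaker bound of the preceding lemma serves for summability only.\<close>
  show "(\<lambda>i. (cmod (cinner_L2 f (?T (F i))))\<^sup>2) summable_on UNIV"
    using bessel_sequence_summable [OF bessel_inv_frame_op [OF frame_bessel]]
    by (simp add: analysis_def)
  have "complex_of_real (\<Sum>\<^sub>\<infinity>i. (cmod (cinner_L2 f (?T (F i))))\<^sup>2) = cinner_L2 f (?T f)"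
    using bessel_frame_op_self [OF frame_bessel, of "?T f"]
    by (simp add: analysis_def inv_frame_op_adjoint frame_op_inv)
  then have "(\<Sum>\<^sub>\<infinity>i. (cmod (cinner_L2 f (?T (F i))))\<^sup>2) = inner f (?T f)"
    by (metis Re_cinner_L2 Re_complex_of_real)
  also have "\<dots> \<le> norm f * (inverse A * norm f)"
    by (rule order_trans [OF norm_cauchy_schwarz]) (intro mult_left_mono inv_frame_op_norm, simp)
  finally show "(\<Sum>\<^sub>\<infinity>i. (cmod (cinner_L2 f (?T (F i))))\<^sup>2) \<le> inverse A * (norm f)\<^sup>2"
    by (simp add: power2_eq_square mult_ac)
qed

section \<open>Perturbing the frame by a Bessel family\<close>

context
  fixes G :: "'i \<Rightarrow> L2" and B' :: real
  assumes G: "bessel_sequence G B'"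
begin

lemma id_minus_mixed_op_canonical_dual:
  "f - mixed_op G (\<lambda>i. inv (mixed_op F F) (F i)) f
    = synthesis (\<lambda>i. inv (mixed_op F F) (F i)) (analysis (\<lambda>i. F i - G i) f)"
proof -
  let ?T = "inv (mixed_op F F)"
  have "synthesis (\<lambda>i. ?T (F i)) (analysis F f) = ?T (synthesis F (analysis F f))"
    by (rule synthesis_image [OF frame_bessel bessel_sequence_summable [OF frame_bessel]
          bounded_linear_inv_frame_op inv_frame_op_scaleC])
  also have "\<dots> = f"
    using inv_frame_op [of f] by (simp only: mixed_op_def o_def)
  finally have "synthesis (\<lambda>i. ?T (F i)) (analysis F f) = f" .
  then show ?thesis
    by (simp add: mixed_op_def [of G] analysis_family_diff synthesis_diff [OF bessel_canonical_dual]
        bessel_sequence_summable [OF frame_bessel] bessel_sequence_summable [OF G])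
qed

lemma onorm_id_minus_mixed_op_canonical_dual:
  "onorm (\<lambda>f. f - mixed_op G (\<lambda>i. inv (mixed_op F F) (F i)) f)
    \<le> A powr (- 1 / 2) * analysis_onorm (\<lambda>i. F i - G i)"
proof (rule onorm_bound)
  have D: "bessel_sequence (\<lambda>i. F i - G i) (2 * B + 2 * B')"
    by (rule bessel_sequence_diff [OF frame_bessel G])
  show "0 \<le> A powr (- 1 / 2) * analysis_onorm (\<lambda>i. F i - G i)"
    using bessel_analysis_onorm_nonneg [OF D] by simp
  fix f
  have "norm (f - mixed_op G (\<lambda>i. inv (mixed_op F F) (F i)) f)
      \<le> sqrt (inverse A) * ell2_norm (analysis (\<lambda>i. F i - G i) f)"
    unfolding id_minus_mixed_op_canonical_dual
    by (rule bessel_norm_synthesis [OF bessel_canonical_dual bessel_sequence_summable [OF D]])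
  also have "\<dots> \<le> sqrt (inverse A) * (analysis_onorm (\<lambda>i. F i - G i) * norm f)"
    using frame_lower_pos by (intro mult_left_mono bessel_analysis_onorm [OF D]) auto
  also have "sqrt (inverse A) = A powr (- 1 / 2)"
    using frame_lower_pos by (simp add: powr_minus powr_half_sqrt real_sqrt_inverse)
  finally show "norm (f - mixed_op G (\<lambda>i. inv (mixed_op F F) (F i)) f)
      \<le> A powr (- 1 / 2) * analysis_onorm (\<lambda>i. F i - G i) * norm f"
    by (simp add: mult.assoc)
qed

text \<open>Insert and remove the mixed term \<open>synthesis F (analysis G f)\<close>; each summand
  then contains the difference family exactly once.\<close>

lemma frame_op_minus_mixed_op:
  "mixed_op F F f - mixed_op G G f
    = synthesis F (analysis (\<lambda>i. F i - G i) f) + synthesis (\<lambda>i. F i - G i) (analysis G f)"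
  by (simp add: mixed_op_def analysis_family_diff synthesis_diff [OF frame_bessel]
      synthesis_family_diff [OF frame_bessel G]
      bessel_sequence_summable [OF frame_bessel] bessel_sequence_summable [OF G])

lemma onorm_id_minus_mixed_op_inv:
  "onorm (\<lambda>f. f - mixed_op G (\<lambda>i. inv (mixed_op F F) (G i)) f)
    \<le> inverse A * (sqrt B + sqrt B') * analysis_onorm (\<lambda>i. F i - G i)"
proof (rule onorm_bound)
  let ?D = "\<lambda>i. F i - G i" and ?T = "inv (mixed_op F F)"
  have D: "bessel_sequence ?D (2 * B + 2 * B')"
    by (rule bessel_sequence_diff [OF frame_bessel G])
  \<comment> \<open>The optimal Bessel bound, so that \<open>\<parallel>U\<^bsub>F-G\<^esub>\<parallel> = \<parallel>C\<^bsub>F-G\<^esub>\<parallel>\<close>.\<close>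
  have D': "bessel_sequence ?D ((analysis_onorm ?D)\<^sup>2)"
    by (rule bessel_analysis_onorm_bessel [OF D])
  have nn: "0 \<le> analysis_onorm ?D" "0 \<le> B" "0 \<le> B'" "0 \<le> inverse A"
    using bessel_analysis_onorm_nonneg [OF D] bessel_sequence_nonneg [OF frame_bessel]
      bessel_sequence_nonneg [OF G] frame_lower_pos by auto
  then show "0 \<le> inverse A * (sqrt B + sqrt B') * analysis_onorm ?D"
    by simp
  fix f
  \<comment> \<open>Writing \<open>f\<close> as the inverse applied to \<open>mixed_op F F f\<close>
    and pulling the inverse out of the series puts the whole expression behind one inverse.\<close>
  have "f - mixed_op G (\<lambda>i. ?T (G i)) f = ?T (mixed_op F F f - mixed_op G G f)"
    using synthesis_image [OF G bessel_sequence_summable [OF G, of f]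
        bounded_linear_inv_frame_op inv_frame_op_scaleC]
    by (simp add: inv_frame_op_diff inv_frame_op mixed_op_def [of G] o_def)
  then have "norm (f - mixed_op G (\<lambda>i. ?T (G i)) f)
      \<le> inverse A * norm (synthesis F (analysis ?D f) + synthesis ?D (analysis G f))"
    using inv_frame_op_norm by (simp add: frame_op_minus_mixed_op)
  also have "norm (synthesis F (analysis ?D f) + synthesis ?D (analysis G f))
      \<le> (sqrt B + sqrt B') * analysis_onorm ?D * norm f"
  proof -
    have "norm (synthesis F (analysis ?D f) + synthesis ?D (analysis G f))
      \<le> sqrt B * ell2_norm (analysis ?D f) + sqrt ((analysis_onorm ?D)\<^sup>2) * ell2_norm (analysis G f)"
      by (intro norm_triangle_mono bessel_norm_synthesis frame_bessel D' bessel_sequence_summable [OF D]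
          bessel_sequence_summable [OF G])
    also have "\<dots> \<le> sqrt B * (analysis_onorm ?D * norm f) + analysis_onorm ?D * (sqrt B' * norm f)"
      using nn by (intro add_mono mult_mono bessel_analysis_onorm [OF D] bessel_sequence_ell2_norm [OF G])
        (auto simp: ell2_norm_nonneg)
    finally show ?thesis
      by (simp add: algebra_simps)
  qed
  finally show "norm (f - mixed_op G (\<lambda>i. ?T (G i)) f)
      \<le> inverse A * (sqrt B + sqrt B') * analysis_onorm ?D * norm f"
    using nn by (simp add: mult_left_mono mult.assoc)
qed

end

end

section \<open>Gabor coefficients and periodization\<close>

text \<open>Enumerating the integers makes the measurability and monotone convergence results for
  \<open>suminf\<close> available.\<close>

lemma infsum_int_eq_suminf: "(\<Sum>\<^sub>\<infinity>j::int. f j :: ennreal) = (\<Sum>n. f (int_decode n))"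
proof -
  have "(\<Sum>\<^sub>\<infinity>j. f j) = (\<Sum>\<^sub>\<infinity>n. f (int_decode n))"
    by (rule infsum_reindex_bij_betw [OF bij_int_decode, symmetric])
  also have "\<dots> = (\<Sum>n. f (int_decode n))"
    by (rule sums_unique [OF has_sum_imp_sums [OF has_sum_infsum]]) (simp add: nonneg_summable_on_complete)
  finally show ?thesis .
qed

lemma borel_measurable_infsum_int [measurable (raw)]:
  fixes f :: "int \<Rightarrow> 'a \<Rightarrow> ennreal"
  assumes [measurable]: "\<And>j. f j \<in> borel_measurable M"
  shows "(\<lambda>x. \<Sum>\<^sub>\<infinity>j. f j x) \<in> borel_measurable M"
  unfolding infsum_int_eq_suminf by measurable

lemma nn_integral_infsum_int:
  fixes f :: "int \<Rightarrow> 'a \<Rightarrow> ennreal"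
  assumes "\<And>j. f j \<in> borel_measurable M"
  shows "(\<integral>\<^sup>+x. (\<Sum>\<^sub>\<infinity>j. f j x) \<partial>M) = (\<Sum>\<^sub>\<infinity>j. \<integral>\<^sup>+x. f j x \<partial>M)"
  unfolding infsum_int_eq_suminf by (rule nn_integral_suminf) (rule assms)

lemma infsum_int_cmult: "(\<Sum>\<^sub>\<infinity>j::int. c * f j :: ennreal) = c * (\<Sum>\<^sub>\<infinity>j. f j)"
  unfolding infsum_int_eq_suminf by simp

lemma infsum_int_add: "(\<Sum>\<^sub>\<infinity>j::int. f j + g j :: ennreal) = (\<Sum>\<^sub>\<infinity>j. f j) + (\<Sum>\<^sub>\<infinity>j. g j)"
  by (rule infsum_add) (simp_all add: nonneg_summable_on_complete)

lemma infsum_int_mono: "(\<And>j. f j \<le> g j) \<Longrightarrow> (\<Sum>\<^sub>\<infinity>j::int. f j :: ennreal) \<le> (\<Sum>\<^sub>\<infinity>j. g j)"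
  by (rule infsum_mono) (auto simp: nonneg_summable_on_complete)

lemma infsum_int_uminus: "(\<Sum>\<^sub>\<infinity>j::int. f (- j)) = (\<Sum>\<^sub>\<infinity>j. f j)"
  by (rule infsum_reindex_bij_betw) (rule bij_uminus)

lemma infsum_int_shift: "(\<Sum>\<^sub>\<infinity>j::int. f (i + j)) = (\<Sum>\<^sub>\<infinity>j. f j)"
  by (rule infsum_reindex_bij_betw) (rule bij_betw_byWitness [of _ "\<lambda>j. j - i"], auto)

lemma infsum_int_sum:
  fixes f :: "'a \<Rightarrow> int \<Rightarrow> ennreal"
  shows "(\<Sum>\<^sub>\<infinity>j. \<Sum>k\<in>K. f k j) = (\<Sum>k\<in>K. \<Sum>\<^sub>\<infinity>j. f k j)"
  by (induction K rule: infinite_finite_induct) (auto simp: infsum_int_add)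

lemma finite_sum_le_infsum_ennreal:
  fixes f :: "'a \<Rightarrow> ennreal"
  assumes "finite K"
  shows "sum f K \<le> infsum f UNIV"
  using infsum_mono_neutral [of f K f UNIV] assms by (simp add: nonneg_summable_on_complete)

section \<open>Translations and folding onto one period\<close>

lemma measurable_lebesgue_shift [measurable]:
  fixes a :: real
  shows "(\<lambda>t. t + a) \<in> lebesgue \<rightarrow>\<^sub>M lebesgue"
  using lebesgue_affine_measurable [of "\<lambda>_. 1 :: real" a] by (simp add: add.commute)

lemma measurable_lebesgue_shift_diff [measurable]:
  fixes a :: real
  shows "(\<lambda>t. t - a) \<in> lebesgue \<rightarrow>\<^sub>M lebesgue"
  using measurable_lebesgue_shift [of "- a"] by simp

lemma nn_integral_lebesgue_shift:
  fixes f :: "real \<Rightarrow> ennreal"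
  assumes "f \<in> borel_measurable lebesgue"
  shows "(\<integral>\<^sup>+t. f (t + a) \<partial>lebesgue) = (\<integral>\<^sup>+t. f t \<partial>lebesgue)"
  using nn_integral_real_affine_lebesgue [OF assms, of 1 a] by (simp add: add.commute)

text \<open>The half-open interval is a fundamental domain: only
  \<open>j = - \<lfloor>t / p\<rfloor>\<close> moves \<open>t\<close> into it.\<close>

lemma infsum_indicator_translates:
  fixes p t :: real
  assumes "0 < p"
  shows "(\<Sum>\<^sub>\<infinity>j::int. indicator {0..<p} (t + of_int j * p) :: ennreal) = 1"
proof -
  have iff: "t + of_int j * p \<in> {0..<p} \<longleftrightarrow> j = - \<lfloor>t / p\<rfloor>" for j
  proof -
    have "t + of_int j * p \<in> {0..<p} \<longleftrightarrow> of_int (- j) \<le> t / p \<and> t / p < of_int (- j) + 1"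
      using assms by (auto simp: field_simps)
    also have "\<dots> \<longleftrightarrow> \<lfloor>t / p\<rfloor> = - j"
      by (simp only: floor_eq_iff)
    finally show ?thesis
      by auto
  qed
  have "(\<Sum>\<^sub>\<infinity>j::int. indicator {0..<p} (t + of_int j * p) :: ennreal)
      = (\<Sum>\<^sub>\<infinity>j::int\<in>{- \<lfloor>t / p\<rfloor>}. indicator {0..<p} (t + of_int j * p))"
    by (rule infsum_cong_neutral) (auto simp: indicator_def iff simp del: atLeastLessThan_iff)
  then show ?thesis
    by (simp add: indicator_def iff del: atLeastLessThan_iff)
qed

text \<open>Multiply by the partition of unity formed by the translated indicators, exchange sum and
  integral, and translate each term back.\<close>

lemma nn_integral_fold:
  fixes w :: "real \<Rightarrow> ennreal"
  assumes "0 < p" and [measurable]: "w \<in> borel_measurable lebesgue"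
  shows "(\<integral>\<^sup>+t. w t \<partial>lebesgue)
    = (\<integral>\<^sup>+t. indicator {0..<p} t * (\<Sum>\<^sub>\<infinity>j::int. w (t - of_int j * p)) \<partial>lebesgue)"
proof -
  have [measurable]: "(indicator {0..<p} :: real \<Rightarrow> ennreal) \<in> borel_measurable lebesgue"
    by (rule borel_measurable_indicator) simp
  have "(\<integral>\<^sup>+t. w t \<partial>lebesgue)
      = (\<integral>\<^sup>+t. (\<Sum>\<^sub>\<infinity>j::int. w t * indicator {0..<p} (t + of_int j * p)) \<partial>lebesgue)"
    using infsum_indicator_translates [OF assms(1)] by (simp add: infsum_int_cmult)
  also have "\<dots> = (\<Sum>\<^sub>\<infinity>j::int. \<integral>\<^sup>+t. w t * indicator {0..<p} (t + of_int j * p) \<partial>lebesgue)"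
    by (rule nn_integral_infsum_int) measurable
  also have "\<dots> = (\<Sum>\<^sub>\<infinity>j::int. \<integral>\<^sup>+t. indicator {0..<p} t * w (t - of_int j * p) \<partial>lebesgue)"
  proof (rule infsum_cong)
    fix j :: int
    show "(\<integral>\<^sup>+t. w t * indicator {0..<p} (t + of_int j * p) \<partial>lebesgue)
        = (\<integral>\<^sup>+t. indicator {0..<p} t * w (t - of_int j * p) \<partial>lebesgue)"
      using nn_integral_lebesgue_shift [of "\<lambda>t. indicator {0..<p} t * w (t - of_int j * p)" "of_int j * p"]
      by (simp add: mult.commute)
  qed
  also have "\<dots> = (\<integral>\<^sup>+t. (\<Sum>\<^sub>\<infinity>j::int. indicator {0..<p} t * w (t - of_int j * p)) \<partial>lebesgue)"
    by (rule nn_integral_infsum_int [symmetric]) measurable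
  finally show ?thesis
    by (simp add: infsum_int_cmult)
qed

section \<open>Exponentials on one period\<close>

definition fourier_char :: "real \<Rightarrow> real \<Rightarrow> complex" where
  "fourier_char \<omega> t = exp (2 * of_real pi * \<i> * of_real \<omega> * of_real t)"

lemma norm_fourier_char [simp]: "cmod (fourier_char \<omega> t) = 1"
proof -
  have "fourier_char \<omega> t = exp (\<i> * of_real (2 * pi * \<omega> * t))"
    by (simp add: fourier_char_def mult_ac)
  then show ?thesis
    by (simp only: norm_exp_i_times)
qed

lemma fourier_char_mult_cnj: "fourier_char \<omega> t * cnj (fourier_char \<nu> t) = fourier_char (\<omega> - \<nu>) t"
  by (simp add: fourier_char_def exp_cnj algebra_simps flip: exp_add)

text \<open>The shift contributes exp (-2 pi i l j) = 1, for every frequency \<open>l * b\<close> at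
  once.\<close>

lemma fourier_char_periodic:
  assumes "b \<noteq> 0"
  shows "fourier_char (of_int l * b) (t - of_int j * inverse b) = fourier_char (of_int l * b) t"
proof -
  have "2 * of_real pi * \<i> * of_real (of_int l * b) * of_real (t - of_int j * inverse b)
      = 2 * of_real pi * \<i> * of_real (of_int l * b) * of_real t
        + of_real (2 * of_int (- (l * j)) * pi) * \<i>"
    using assms by (simp add: field_simps)
  then have "fourier_char (of_int l * b) (t - of_int j * inverse b)
      = fourier_char (of_int l * b) t * exp (of_real (2 * of_int (- (l * j)) * pi) * \<i>)"
    by (simp only: fourier_char_def exp_add)
  also have "exp (of_real (2 * of_int (- (l * j)) * pi) * \<i>) = 1"
    by (rule exp_integer_2pi) (rule Ints_of_int)
  finally show ?thesis
    by simp
qed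

lemma continuous_on_fourier_char: "continuous_on S (fourier_char \<omega>)"
  unfolding fourier_char_def by (intro continuous_intros)

lemma borel_measurable_fourier_char [measurable]: "fourier_char \<omega> \<in> borel_measurable lebesgue"
  by (rule measurable_completion) (simp add: borel_measurable_continuous_onI continuous_on_fourier_char)

text \<open>Orthogonality of the exponentials: for \<open>n \<noteq> 0\<close> the antiderivative
  \<open>fourier_char (of_int n * b) t / z\<close> takes equal values at both ends of the
  period.\<close>

lemma has_bochner_integral_fourier_char:
  assumes "b > 0"
  shows "has_bochner_integral lborel
    (\<lambda>t. indicator {0..inverse b} t *\<^sub>R fourier_char (of_int n * b) t)
    (if n = 0 then of_real (inverse b) else 0)"
proof (cases "n = 0")
  case True
  have "has_bochner_integral lborel (\<lambda>t. indicator {0..inverse b} t *\<^sub>R fourier_char (of_int n * b) t)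
     (complex_of_real (inverse b) - complex_of_real 0)"
    using assms True
    by (intro has_bochner_integral_FTC_Icc continuous_on_fourier_char)
      (auto simp: fourier_char_def intro!: derivative_eq_intros)
  with True show ?thesis
    by simp
next
  case False
  define z where "z = 2 * of_real pi * \<i> * of_real (of_int n * b)"
  have z: "z \<noteq> 0"
    using False assms by (simp add: z_def)
  have "has_bochner_integral lborel (\<lambda>t. indicator {0..inverse b} t *\<^sub>R fourier_char (of_int n * b) t)
     (fourier_char (of_int n * b) (inverse b) / z - fourier_char (of_int n * b) 0 / z)"
  proof (intro has_bochner_integral_FTC_Icc continuous_on_fourier_char)
    fix t
    have "((\<lambda>t. exp (z * t) / z) has_field_derivative exp (z * of_real t)) (at (of_real t))"
      using z by (auto intro!: derivative_eq_intros)
    from has_vector_derivative_real_field [OF this] show "((\<lambda>t. fourier_char (of_int n * b) t / z) has_vector_derivative fourier_char (of_int n * b) t)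
        (at t within {0..inverse b})"
      by (simp add: fourier_char_def z_def)
  qed (use assms in auto)
  moreover have "fourier_char (of_int n * b) (inverse b) = fourier_char (of_int n * b) 0"
    using fourier_char_periodic [of b n 0 "-1"] assms by simp
  ultimately show ?thesis
    using False by simp
qed

lemma has_bochner_integral_complex_of_real_iff:
  "has_bochner_integral M (\<lambda>x. complex_of_real (f x)) (complex_of_real I) \<longleftrightarrow> has_bochner_integral M f I"
  using has_bochner_integral_Re [of M "\<lambda>x. complex_of_real (f x)" "complex_of_real I"]
    has_bochner_integral_bounded_linear [OF bounded_linear_of_real, of M f I] by auto

text \<open>Expanding the square gives a double sum that orthogonality reduces to its diagonal. An
  inequality suffices, so monotonicity replaces the half-open interval by the closed one on which
  the exponentials were integrated.\<close>

lemma nn_integral_trig_polynomial: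
  assumes b: "b > 0" and L: "finite L"
  shows "(\<integral>\<^sup>+t. indicator {0..<inverse b} t *
        ennreal ((cmod (\<Sum>l\<in>L. c l * fourier_char (of_int l * b) t))\<^sup>2) \<partial>lebesgue)
      \<le> ennreal (inverse b * (\<Sum>l\<in>L. (cmod (c l))\<^sup>2))"
proof -
  define P where "P t = (\<Sum>l\<in>L. c l * fourier_char (of_int l * b) t)" for t
  have P: "complex_of_real ((cmod (P t))\<^sup>2)
      = (\<Sum>l\<in>L. \<Sum>m\<in>L. (c l * cnj (c m)) * fourier_char (of_int (l - m) * b) t)" for t
  proof -
    have "fourier_char (of_int (l - m) * b) t = fourier_char (of_int l * b) t * cnj (fourier_char (of_int m * b) t)" for l m
      by (simp add: fourier_char_mult_cnj left_diff_distrib)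
    then show ?thesis
      unfolding complex_norm_square P_def cnj_sum sum_product by (simp add: mult_ac)
  qed
  have "has_bochner_integral lborel
      (\<lambda>t. \<Sum>l\<in>L. \<Sum>m\<in>L. (c l * cnj (c m)) *
        (indicator {0..inverse b} t *\<^sub>R fourier_char (of_int (l - m) * b) t))
      (\<Sum>l\<in>L. \<Sum>m\<in>L. (c l * cnj (c m)) * (if l - m = 0 then of_real (inverse b) else 0))"
    by (intro has_bochner_integral_sum has_bochner_integral_mult_right has_bochner_integral_fourier_char b)
  also have "(\<lambda>t. \<Sum>l\<in>L. \<Sum>m\<in>L. (c l * cnj (c m)) *
        (indicator {0..inverse b} t *\<^sub>R fourier_char (of_int (l - m) * b) t))
      = (\<lambda>t. complex_of_real (indicator {0..inverse b} t * (cmod (P t))\<^sup>2))"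
    unfolding of_real_mult P by (simp add: scaleR_conv_of_real sum_distrib_left mult_ac)
  also have "(\<Sum>l\<in>L. \<Sum>m\<in>L. (c l * cnj (c m)) * (if l - m = 0 then of_real (inverse b) else 0))
      = (\<Sum>l\<in>L. (c l * cnj (c l)) * of_real (inverse b))"
    using L by (intro sum.cong) (auto simp: if_distrib cong: if_cong)
  also have "\<dots> = complex_of_real (inverse b * (\<Sum>l\<in>L. (cmod (c l))\<^sup>2))"
    unfolding complex_norm_square [symmetric] by (simp add: sum_distrib_left mult.commute)
  finally have "has_bochner_integral lborel (\<lambda>t. indicator {0..inverse b} t * (cmod (P t))\<^sup>2)
      (inverse b * (\<Sum>l\<in>L. (cmod (c l))\<^sup>2))"
    by (subst (asm) has_bochner_integral_complex_of_real_iff)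
  then have "(\<integral>\<^sup>+t. ennreal (indicator {0..inverse b} t * (cmod (P t))\<^sup>2) \<partial>lborel)
      = ennreal (inverse b * (\<Sum>l\<in>L. (cmod (c l))\<^sup>2))"
    by (auto simp: has_bochner_integral_iff nn_integral_eq_integral)
  moreover have "(\<integral>\<^sup>+t. indicator {0..<inverse b} t * ennreal ((cmod (P t))\<^sup>2) \<partial>lebesgue)
      \<le> (\<integral>\<^sup>+t. ennreal (indicator {0..inverse b} t * (cmod (P t))\<^sup>2) \<partial>lebesgue)"
    by (intro nn_integral_mono) (simp add: indicator_def)
  ultimately show ?thesis
    by (simp only: P_def nn_integral_completion)
qed

text \<open>Expand (b x - y)^2 / b. The weight \<open>b\<close> cancels the period length
  \<open>inverse b\<close> in the integral of a squared trigonometric polynomial. The factor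
  \<open>y\<close> may be infinite because it will be a periodization.\<close>

lemma ennreal_amgm:
  assumes "0 < b" "0 \<le> x"
  shows "2 * (ennreal x * y) \<le> ennreal b * ennreal (x\<^sup>2) + ennreal (inverse b) * (y * y)"
proof (cases y)
  case (real r)
  have "0 \<le> inverse b * (b * x - r)\<^sup>2"
    using assms by simp
  also have "\<dots> = b * x\<^sup>2 + inverse b * (r * r) - 2 * (x * r)"
    using assms by (simp add: field_simps power2_eq_square)
  finally have "ennreal (2 * (x * r)) \<le> ennreal (b * x\<^sup>2 + inverse b * (r * r))"
    by (intro ennreal_leI) simp
  then show ?thesis
    using assms real by (simp add: ennreal_mult ennreal_plus)
next
  case top
  then show ?thesis
    using assms by (simp add: ennreal_mult_top)
qed

section \<open>Gabor coefficients of a single window\<close>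

lemma modulation_fourier_char: "modulation \<omega> g t = fourier_char \<omega> t * g t"
  by (simp add: modulation_def fourier_char_def)

lemma sq_integrable_modulation:
  assumes "sq_integrable g"
  shows "sq_integrable (modulation \<omega> g)"
proof -
  have "modulation \<omega> g = (\<lambda>t. fourier_char \<omega> t * g t)"
    by (simp add: fun_eq_iff modulation_fourier_char)
  moreover have "(\<lambda>t. fourier_char \<omega> t * g t) \<in> borel_measurable lebesgue"
    using assms by (intro borel_measurable_times borel_measurable_fourier_char) (simp add: sq_integrable_def)
  ultimately show ?thesis
    using assms by (simp add: sq_integrable_def norm_mult)
qed

text \<open>The autocorrelation of \<open>u\<close>, summed over all shifts by integer multiples of
  \<open>p\<close>.\<close>

definition autocorr :: "real \<Rightarrow> (real \<Rightarrow> ennreal) \<Rightarrow> ennreal" where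
  "autocorr p u = (\<integral>\<^sup>+t. u t * (\<Sum>\<^sub>\<infinity>j::int. u (t - of_int j * p)) \<partial>lebesgue)"

lemma periodization_shift:
  fixes u :: "real \<Rightarrow> ennreal" and i :: int
  shows "(\<Sum>\<^sub>\<infinity>j::int. u (t - of_int i * p - of_int j * p)) = (\<Sum>\<^sub>\<infinity>j::int. u (t - of_int j * p))"
  using infsum_int_shift [of "\<lambda>j. u (t - of_int j * p)" i] by (simp add: algebra_simps)

text \<open>The periodization is itself \<open>p\<close>-periodic, so it factors out when the
  integral is folded; the remaining \<open>u\<close> folds to a second copy.\<close>

lemma autocorr_fold:
  assumes "0 < p" and [measurable]: "u \<in> borel_measurable lebesgue"
  shows "autocorr p u = (\<integral>\<^sup>+t. indicator {0..<p} t *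
    ((\<Sum>\<^sub>\<infinity>j::int. u (t - of_int j * p)) * (\<Sum>\<^sub>\<infinity>j::int. u (t - of_int j * p))) \<partial>lebesgue)"
proof -
  define \<Phi> where "\<Phi> t = (\<Sum>\<^sub>\<infinity>j::int. u (t - of_int j * p))" for t
  have [measurable]: "\<Phi> \<in> borel_measurable lebesgue"
    unfolding \<Phi>_def [abs_def] by measurable
  have per: "\<Phi> (t - of_int j * p) = \<Phi> t" for t j
    unfolding \<Phi>_def by (rule periodization_shift)
  have "autocorr p u = (\<integral>\<^sup>+t. \<Phi> t * u t \<partial>lebesgue)"
    by (simp add: autocorr_def \<Phi>_def mult.commute)
  also have "\<dots> = (\<integral>\<^sup>+t. indicator {0..<p} t *
      (\<Sum>\<^sub>\<infinity>j::int. \<Phi> t * u (t - of_int j * p)) \<partial>lebesgue)"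
    using nn_integral_fold [OF assms(1), of "\<lambda>t. \<Phi> t * u t"] by (simp add: per)
  also have "\<dots> = (\<integral>\<^sup>+t. indicator {0..<p} t * (\<Phi> t * \<Phi> t) \<partial>lebesgue)"
    unfolding infsum_int_cmult by (simp add: \<Phi>_def)
  finally show ?thesis
    by (simp add: \<Phi>_def)
qed

text \<open>Duality replaces Parseval's identity for the periodization: with \<open>P = \<Sum>c\<^sub>l fourier_char (l b)\<close>, the
  sum \<open>N = \<Sum>\<bar>c\<^sub>l\<bar>\<^sup>2\<close> equals \<open>\<langle>f, P \<psi>\<rangle>\<close>, and after folding onto one period, AM-GM
  bounds \<open>2 N\<close> by \<open>b \<integral>\<bar>P\<bar>\<^sup>2 = N\<close> plus \<open>b\<^sup>-\<^sup>1\<close> times the autocorrelation of \<open>\<bar>f \<psi>\<bar>\<close>.\<close>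

lemma gabor_coefficients_le_autocorr:
  assumes f: "sq_integrable f" and \<psi>: "sq_integrable \<psi>" and b: "b > 0" and L: "finite L"
  shows "ennreal (\<Sum>l\<in>L. (cmod (cinner_L2 (abs_L2 f) (abs_L2 (modulation (of_int l * b) \<psi>))))\<^sup>2)
    \<le> ennreal (inverse b) * autocorr (inverse b) (\<lambda>t. ennreal (cmod (f t) * cmod (\<psi> t)))"
proof -
  define p where "p = inverse b"
  have p: "0 < p"
    using b by (simp add: p_def)
  define c where "c l = cinner_L2 (abs_L2 f) (abs_L2 (modulation (of_int l * b) \<psi>))" for l
  define P where "P t = (\<Sum>l\<in>L. c l * fourier_char (of_int l * b) t)" for t
  define N where "N = (\<Sum>l\<in>L. (cmod (c l))\<^sup>2)"
  define u where "u t = ennreal (cmod (f t) * cmod (\<psi> t))" for t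
  define \<Phi> where "\<Phi> t = (\<Sum>\<^sub>\<infinity>j::int. u (t - of_int j * p))" for t
  have [measurable]: "f \<in> borel_measurable lebesgue" "\<psi> \<in> borel_measurable lebesgue"
    using f \<psi> by (auto simp: sq_integrable_def)
  have [measurable]: "u \<in> borel_measurable lebesgue"
    unfolding u_def [abs_def] by measurable
  have [measurable]: "\<Phi> \<in> borel_measurable lebesgue"
    unfolding \<Phi>_def [abs_def] by measurable
  have [measurable]: "P \<in> borel_measurable lebesgue"
    unfolding P_def [abs_def] by measurable
  have [measurable]: "(indicator {0..<p} :: real \<Rightarrow> ennreal) \<in> borel_measurable lebesgue"
    by (rule borel_measurable_indicator) simp
  have N: "0 \<le> N"
    by (simp add: N_def sum_nonneg)
  have P_per: "P (t - of_int j * p) = P t" for t j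
    using b by (simp add: P_def p_def fourier_char_periodic)
  have int: "integrable lebesgue (\<lambda>t. f t * cnj (modulation (of_int l * b) \<psi> t))" for l
    by (rule integrable_mult_cnj [OF f sq_integrable_modulation [OF \<psi>]])
  have "complex_of_real N = (\<Sum>l\<in>L. cnj (c l) * c l)"
    unfolding N_def of_real_sum complex_norm_square by (simp add: mult.commute)
  also have "\<dots> = (\<Sum>l\<in>L. integral\<^sup>L lebesgue
      (\<lambda>t. cnj (c l) * (f t * cnj (modulation (of_int l * b) \<psi> t))))"
    by (simp add: int) (simp add: c_def cinner_abs_L2 f sq_integrable_modulation \<psi>)
  also have "\<dots> = integral\<^sup>L lebesgue
      (\<lambda>t. \<Sum>l\<in>L. cnj (c l) * (f t * cnj (modulation (of_int l * b) \<psi> t)))"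
    by (intro Bochner_Integration.integral_sum [symmetric] integrable_mult_right int)
  also have "\<dots> = integral\<^sup>L lebesgue (\<lambda>t. f t * cnj (\<psi> t) * cnj (P t))"
    by (simp add: P_def modulation_fourier_char sum_distrib_left mult_ac)
  finally have N_int: "complex_of_real N = integral\<^sup>L lebesgue (\<lambda>t. f t * cnj (\<psi> t) * cnj (P t))" .
  have "integrable lebesgue
      (\<lambda>t. \<Sum>l\<in>L. cnj (c l) * (f t * cnj (modulation (of_int l * b) \<psi> t)))"
    by (intro Bochner_Integration.integrable_sum integrable_mult_right int)
  then have "integrable lebesgue (\<lambda>t. f t * cnj (\<psi> t) * cnj (P t))"
    by (simp add: P_def modulation_fourier_char sum_distrib_left mult_ac)
  from integral_norm_bound_ennreal [OF this]
  have "ennreal (cmod (complex_of_real N)) \<le> (\<integral>\<^sup>+t. ennreal (cmod (f t * cnj (\<psi> t) * cnj (P t))) \<partial>lebesgue)"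
    unfolding N_int .
  then have "ennreal N \<le> (\<integral>\<^sup>+t. ennreal (cmod (P t)) * u t \<partial>lebesgue)"
    using N by (simp add: norm_mult u_def ennreal_mult mult_ac)
  \<comment> \<open>\<open>P\<close> has period \<open>p\<close>, so folding periodizes only
    \<open>u\<close>.\<close>
  also have "\<dots> = (\<integral>\<^sup>+t. indicator {0..<p} t * (ennreal (cmod (P t)) * \<Phi> t) \<partial>lebesgue)"
    by (subst nn_integral_fold [OF p]) (simp_all add: P_per infsum_int_cmult \<Phi>_def)
  finally have "2 * ennreal N \<le> 2 * (\<integral>\<^sup>+t. indicator {0..<p} t * (ennreal (cmod (P t)) * \<Phi> t) \<partial>lebesgue)"
    by (rule mult_left_mono) simp
  also have "\<dots> = (\<integral>\<^sup>+t. indicator {0..<p} t * (2 * (ennreal (cmod (P t)) * \<Phi> t)) \<partial>lebesgue)"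
    by (subst nn_integral_cmult [symmetric]) (simp_all add: mult_ac)
  also have "\<dots> \<le> (\<integral>\<^sup>+t. indicator {0..<p} t *
      (ennreal b * ennreal ((cmod (P t))\<^sup>2) + ennreal p * (\<Phi> t * \<Phi> t)) \<partial>lebesgue)"
    unfolding p_def by (intro nn_integral_mono mult_left_mono ennreal_amgm b) auto
  also have "\<dots> = (\<integral>\<^sup>+t. ennreal b * (indicator {0..<p} t * ennreal ((cmod (P t))\<^sup>2)) +
      ennreal p * (indicator {0..<p} t * (\<Phi> t * \<Phi> t)) \<partial>lebesgue)"
    by (intro nn_integral_cong) (simp add: distrib_left mult_ac)
  also have "\<dots> = ennreal b * (\<integral>\<^sup>+t. indicator {0..<p} t * ennreal ((cmod (P t))\<^sup>2) \<partial>lebesgue)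
      + ennreal p * (\<integral>\<^sup>+t. indicator {0..<p} t * (\<Phi> t * \<Phi> t) \<partial>lebesgue)"
    by (simp add: nn_integral_add nn_integral_cmult)
  also have "(\<integral>\<^sup>+t. indicator {0..<p} t * (\<Phi> t * \<Phi> t) \<partial>lebesgue) = autocorr p u"
    by (subst autocorr_fold [OF p]) (simp_all add: \<Phi>_def)
  also have "ennreal b * (\<integral>\<^sup>+t. indicator {0..<p} t * ennreal ((cmod (P t))\<^sup>2) \<partial>lebesgue)
      \<le> ennreal b * ennreal (p * N)"
    unfolding P_def p_def N_def by (intro mult_left_mono nn_integral_trig_polynomial b L) simp
  also have "ennreal b * ennreal (p * N) = ennreal N"
    using b N by (simp add: p_def flip: ennreal_mult)
  finally have "ennreal N + ennreal N \<le> ennreal N + ennreal p * autocorr p u"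
    by (simp add: mult_2 add_right_mono)
  \<comment> \<open>Cancelling is sound because \<open>N\<close> is a finite real, which is why the
    lemma is restricted to a finite set \<open>L\<close>.\<close>
  then have "ennreal N \<le> ennreal p * autocorr p u"
    by (simp add: ennreal_add_left_cancel_le)
  then show ?thesis
    by (simp add: N_def c_def p_def u_def [abs_def])
qed

text \<open>AM-GM decouples \<open>\<bar>f(t) f(t - j p)\<bar>\<close>; translating by \<open>j p\<close> and replacing \<open>j\<close> by \<open>-j\<close>
  identifies the two resulting terms.\<close>

lemma autocorr_le_weighted:
  assumes [measurable]: "f \<in> borel_measurable lebesgue" "\<psi> \<in> borel_measurable lebesgue"
  shows "autocorr p (\<lambda>t. ennreal (cmod (f t) * cmod (\<psi> t)))
    \<le> (\<integral>\<^sup>+t. ennreal ((cmod (f t))\<^sup>2) *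
        (\<Sum>\<^sub>\<infinity>j::int. ennreal (cmod (\<psi> (t - of_int j * p)) * cmod (\<psi> t))) \<partial>lebesgue)"
proof -
  define u where "u t = ennreal (cmod (f t) * cmod (\<psi> t))" for t
  define I where "I j = (\<integral>\<^sup>+t. ennreal ((cmod (f t))\<^sup>2) *
      ennreal (cmod (\<psi> (t - of_int j * p)) * cmod (\<psi> t)) \<partial>lebesgue)" for j :: int
  have [measurable]: "u \<in> borel_measurable lebesgue"
    unfolding u_def [abs_def] by measurable
  have pointwise: "2 * (u t * u s) \<le> ennreal ((cmod (f t))\<^sup>2) * ennreal (cmod (\<psi> s) * cmod (\<psi> t))
      + ennreal ((cmod (f s))\<^sup>2) * ennreal (cmod (\<psi> s) * cmod (\<psi> t))" for s t
  proof -
    have "2 * (cmod (f t) * cmod (f s)) \<le> (cmod (f t))\<^sup>2 + (cmod (f s))\<^sup>2"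
      using sum_squares_bound [of "cmod (f t)" "cmod (f s)"] by (simp add: mult.assoc)
    then have "2 * (cmod (f t) * cmod (f s)) * (cmod (\<psi> s) * cmod (\<psi> t))
        \<le> ((cmod (f t))\<^sup>2 + (cmod (f s))\<^sup>2) * (cmod (\<psi> s) * cmod (\<psi> t))"
      by (rule mult_right_mono) simp
    then have "2 * (cmod (f t) * cmod (\<psi> t) * (cmod (f s) * cmod (\<psi> s)))
        \<le> (cmod (f t))\<^sup>2 * (cmod (\<psi> s) * cmod (\<psi> t)) + (cmod (f s))\<^sup>2 * (cmod (\<psi> s) * cmod (\<psi> t))"
      by (simp add: algebra_simps)
    then have "ennreal (2 * (cmod (f t) * cmod (\<psi> t) * (cmod (f s) * cmod (\<psi> s))))
        \<le> ennreal ((cmod (f t))\<^sup>2 * (cmod (\<psi> s) * cmod (\<psi> t)) + (cmod (f s))\<^sup>2 * (cmod (\<psi> s) * cmod (\<psi> t)))"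
      by (rule ennreal_leI)
    then show ?thesis
      by (simp add: u_def ennreal_mult ennreal_plus)
  qed
  have "2 * (\<integral>\<^sup>+t. u t * u (t - of_int j * p) \<partial>lebesgue) \<le> I j + I (- j)" for j
  proof -
    have "2 * (\<integral>\<^sup>+t. u t * u (t - of_int j * p) \<partial>lebesgue)
        = (\<integral>\<^sup>+t. 2 * (u t * u (t - of_int j * p)) \<partial>lebesgue)"
      by (rule nn_integral_cmult [symmetric]) measurable
    also have "\<dots> \<le> (\<integral>\<^sup>+t. ennreal ((cmod (f t))\<^sup>2) * ennreal (cmod (\<psi> (t - of_int j * p)) * cmod (\<psi> t))
        + ennreal ((cmod (f (t - of_int j * p)))\<^sup>2) *
          ennreal (cmod (\<psi> (t - of_int j * p)) * cmod (\<psi> t)) \<partial>lebesgue)"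
      by (intro nn_integral_mono pointwise)
    also have "\<dots> = I j + (\<integral>\<^sup>+t. ennreal ((cmod (f (t - of_int j * p)))\<^sup>2) *
          ennreal (cmod (\<psi> (t - of_int j * p)) * cmod (\<psi> t)) \<partial>lebesgue)"
      unfolding I_def by (rule nn_integral_add) measurable
    also have "(\<integral>\<^sup>+t. ennreal ((cmod (f (t - of_int j * p)))\<^sup>2) *
          ennreal (cmod (\<psi> (t - of_int j * p)) * cmod (\<psi> t)) \<partial>lebesgue) = I (- j)"
      using nn_integral_lebesgue_shift [of "\<lambda>t. ennreal ((cmod (f (t - of_int j * p)))\<^sup>2) *
          ennreal (cmod (\<psi> (t - of_int j * p)) * cmod (\<psi> t))" "of_int j * p"]
      by (simp add: I_def mult.commute)
    finally show ?thesis .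
  qed
  then have "(\<Sum>\<^sub>\<infinity>j. 2 * (\<integral>\<^sup>+t. u t * u (t - of_int j * p) \<partial>lebesgue)) \<le> (\<Sum>\<^sub>\<infinity>j. I j + I (- j))"
    by (rule infsum_int_mono)
  also have "\<dots> = 2 * (\<Sum>\<^sub>\<infinity>j. I j)"
    by (simp add: infsum_int_add infsum_int_uminus mult_2)
  finally have "(\<Sum>\<^sub>\<infinity>j::int. \<integral>\<^sup>+t. u t * u (t - of_int j * p) \<partial>lebesgue) \<le> (\<Sum>\<^sub>\<infinity>j. I j)"
    by (simp add: infsum_int_cmult ennreal_mult_le_mult_iff)
  also have "(\<Sum>\<^sub>\<infinity>j::int. \<integral>\<^sup>+t. u t * u (t - of_int j * p) \<partial>lebesgue) = autocorr p u"
    by (simp add: autocorr_def infsum_int_cmult flip: nn_integral_infsum_int)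
  also have "(\<Sum>\<^sub>\<infinity>j. I j) = (\<integral>\<^sup>+t. ennreal ((cmod (f t))\<^sup>2) *
        (\<Sum>\<^sub>\<infinity>j::int. ennreal (cmod (\<psi> (t - of_int j * p)) * cmod (\<psi> t))) \<partial>lebesgue)"
    unfolding I_def by (subst nn_integral_infsum_int [symmetric]) (simp_all add: infsum_int_cmult)
  finally show ?thesis
    by (simp add: u_def [abs_def])
qed

section \<open>Nonstationary Gabor systems\<close>

text \<open>Exchange the two sums: the shift index of each periodization becomes the index
  \<open>l\<close> of \<open>G_corr\<close>, and the finite set \<open>K\<close> is then enlarged to
  all windows.\<close>

lemma sum_periodized_le_G_corr:
  fixes \<psi> :: "int \<Rightarrow> real \<Rightarrow> complex"
  assumes K: "finite K" and b: "\<And>k. 0 < b k"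
  shows "(\<Sum>k\<in>K. ennreal (inverse (b k)) *
      (\<Sum>\<^sub>\<infinity>j::int. ennreal (cmod (\<psi> k (t - of_int j * inverse (b k))) * cmod (\<psi> k t))))
    \<le> (\<Sum>\<^sub>\<infinity>l. G_corr \<psi> b l t)"
proof -
  have "(\<Sum>k\<in>K. ennreal (inverse (b k)) *
      (\<Sum>\<^sub>\<infinity>j::int. ennreal (cmod (\<psi> k (t - of_int j * inverse (b k))) * cmod (\<psi> k t))))
    = (\<Sum>\<^sub>\<infinity>j::int. \<Sum>k\<in>K. ennreal (inverse (b k) *
        cmod (\<psi> k (t - of_int j * inverse (b k))) * cmod (\<psi> k t)))"
    unfolding infsum_int_sum infsum_int_cmult [symmetric]
    using b by (simp add: less_imp_le mult.assoc flip: ennreal_mult)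
  also have "\<dots> \<le> (\<Sum>\<^sub>\<infinity>l. G_corr \<psi> b l t)"
    unfolding G_corr_def by (intro infsum_int_mono finite_sum_le_infsum_ennreal K)
  finally show ?thesis .
qed

text \<open>Adding the single-window estimates collects all windows into one weight against the
  squared modulus of \<open>F\<close>, and that weight is at most \<open>C\<close> almost
  everywhere.\<close>

lemma bessel_sequence_nsg_family:
  assumes \<psi>: "\<And>k. sq_integrable (\<psi> k)" and b: "\<And>k. 0 < b k"
    and C: "AE t in lebesgue. (\<Sum>\<^sub>\<infinity>l. G_corr \<psi> b l t) \<le> ennreal C" "0 \<le> C"
  shows "bessel_sequence (nsg_family \<psi> b) C"
proof (rule bessel_sequenceI)
  fix f :: L2 and J :: "(int \<times> int) set"
  assume J: "finite J"
  obtain F where F: "sq_integrable F" "f = abs_L2 F"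
    by (rule L2_cases)
  have [measurable]: "F \<in> borel_measurable lebesgue" "\<And>k. \<psi> k \<in> borel_measurable lebesgue"
    using F \<psi> by (auto simp: sq_integrable_def)
  define W where "W k t = (\<Sum>\<^sub>\<infinity>j::int. ennreal (cmod (\<psi> k (t - of_int j * inverse (b k))) * cmod (\<psi> k t)))" for k t
  have [measurable]: "W k \<in> borel_measurable lebesgue" for k
    unfolding W_def [abs_def] by measurable
  \<comment> \<open>Enlarging \<open>J\<close> to a rectangle groups the frequencies by
    window.\<close>
  have "(\<Sum>i\<in>J. (cmod (cinner_L2 f (nsg_family \<psi> b i)))\<^sup>2)
      \<le> (\<Sum>i\<in>fst ` J \<times> snd ` J. (cmod (cinner_L2 f (nsg_family \<psi> b i)))\<^sup>2)"
    using J by (intro sum_mono2) (auto simp: rev_image_eqI)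
  also have "\<dots> = (\<Sum>k\<in>fst ` J. \<Sum>l\<in>snd ` J.
      (cmod (cinner_L2 (abs_L2 F) (abs_L2 (modulation (of_int l * b k) (\<psi> k)))))\<^sup>2)"
    by (simp add: sum.cartesian_product nsg_family_def F(2) case_prod_unfold)
  finally have "ennreal (\<Sum>i\<in>J. (cmod (cinner_L2 f (nsg_family \<psi> b i)))\<^sup>2)
      \<le> (\<Sum>k\<in>fst ` J. ennreal (\<Sum>l\<in>snd ` J.
        (cmod (cinner_L2 (abs_L2 F) (abs_L2 (modulation (of_int l * b k) (\<psi> k)))))\<^sup>2))"
    by (subst sum_ennreal) (auto intro!: ennreal_leI sum_nonneg)
  also have "\<dots> \<le> (\<Sum>k\<in>fst ` J. ennreal (inverse (b k)) *
      (\<integral>\<^sup>+t. ennreal ((cmod (F t))\<^sup>2) * W k t \<partial>lebesgue))"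
    unfolding W_def using J
    by (intro sum_mono order_trans [OF gabor_coefficients_le_autocorr [OF F(1) \<psi> b]]
        mult_left_mono autocorr_le_weighted) auto
  also have "\<dots> = (\<integral>\<^sup>+t. ennreal ((cmod (F t))\<^sup>2) * (\<Sum>k\<in>fst ` J. ennreal (inverse (b k)) * W k t) \<partial>lebesgue)"
    by (subst nn_integral_cmult [symmetric], measurable, subst nn_integral_sum [symmetric], measurable)
      (simp add: sum_distrib_left mult_ac)
  also have "\<dots> \<le> (\<integral>\<^sup>+t. ennreal C * ennreal ((cmod (F t))\<^sup>2) \<partial>lebesgue)"
  proof (rule nn_integral_mono_AE)
    show "AE t in lebesgue. ennreal ((cmod (F t))\<^sup>2) * (\<Sum>k\<in>fst ` J. ennreal (inverse (b k)) * W k t)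
        \<le> ennreal C * ennreal ((cmod (F t))\<^sup>2)"
      using C(1)
    proof eventually_elim
      case (elim t)
      have "(\<Sum>k\<in>fst ` J. ennreal (inverse (b k)) * W k t) \<le> (\<Sum>\<^sub>\<infinity>l. G_corr \<psi> b l t)"
        unfolding W_def using J by (intro sum_periodized_le_G_corr b) auto
      with elim show ?case
        by (subst mult.commute) (intro mult_right_mono, auto)
    qed
  qed
  also have "\<dots> = ennreal (C * (norm f)\<^sup>2)"
    using C(2) by (simp add: nn_integral_cmult ennreal_norm_abs_L2 [OF F(1)] F(2) ennreal_mult)
  finally show "(\<Sum>i\<in>J. (cmod (cinner_L2 f (nsg_family \<psi> b i)))\<^sup>2) \<le> C * (norm f)\<^sup>2"
    using C(2) by (simp add: ennreal_le_iff)
qed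

section \<open>From Wiener windows to Bessel bounds\<close>

text \<open>On each unit cell the integral of the modulus is at most its essential supremum, so such
  a window lies in L1; being also bounded, it lies in L2. This keeps \<open>abs_L2\<close> inside
  its domain.\<close>

lemma wiener_space_sq_integrable:
  assumes "g \<in> wiener_space"
  shows "sq_integrable g"
proof -
  have [measurable]: "g \<in> borel_measurable lebesgue"
    using assms by (simp add: wiener_space_def)
  define E where "E = esssup lebesgue (\<lambda>t. ennreal (cmod (g t)))"
  have E: "E < \<infinity>"
    using assms by (simp add: wiener_space_def E_def)
  have [measurable]: "(indicator {0..<1} :: real \<Rightarrow> ennreal) \<in> borel_measurable lebesgue"
    by (rule borel_measurable_indicator) simp
  let ?I = "lebesgue_on {0..1::real}"
  have on_unit: "(\<integral>\<^sup>+t. indicator {0..<1} t * ennreal (cmod (g (t + of_int k))) \<partial>lebesgue)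
      \<le> esssup ?I (\<lambda>t. ennreal (cmod (g (t + of_int k))))" for k :: int
  proof -
    let ?M = "esssup ?I (\<lambda>t. ennreal (cmod (g (t + of_int k))))"
    have "(\<integral>\<^sup>+t. indicator {0..<1} t * ennreal (cmod (g (t + of_int k))) \<partial>lebesgue)
        \<le> (\<integral>\<^sup>+t. ennreal (cmod (g (t + of_int k))) * indicator {0..1} t \<partial>lebesgue)"
      by (intro nn_integral_mono) (auto simp: indicator_def)
    also have "\<dots> = (\<integral>\<^sup>+t. ennreal (cmod (g (t + of_int k))) \<partial>?I)"
      by (subst nn_integral_restrict_space) auto
    also have "\<dots> \<le> (\<integral>\<^sup>+t. ?M \<partial>?I)"
      by (rule nn_integral_mono_AE) (rule esssup_AE)
    also have "\<dots> = ?M"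
      by (simp add: emeasure_restrict_space)
    finally show ?thesis .
  qed
  have "(\<integral>\<^sup>+t. ennreal (cmod (g t)) \<partial>lebesgue)
      = (\<Sum>\<^sub>\<infinity>j::int. \<integral>\<^sup>+t. indicator {0..<1} t * ennreal (cmod (g (t - of_int j))) \<partial>lebesgue)"
    by (subst nn_integral_fold [of 1], simp, measurable, subst nn_integral_infsum_int [symmetric])
      (simp_all add: infsum_int_cmult)
  \<comment> \<open>Folding produces shifts by \<open>- j\<close>, the Wiener norm uses
    \<open>+ j\<close>.\<close>
  also have "\<dots> = (\<Sum>\<^sub>\<infinity>j::int. \<integral>\<^sup>+t. indicator {0..<1} t * ennreal (cmod (g (t + of_int j))) \<partial>lebesgue)"
    by (subst infsum_int_uminus [symmetric]) simp
  also have "\<dots> \<le> (\<Sum>\<^sub>\<infinity>j::int. esssup ?I (\<lambda>t. ennreal (cmod (g (t + of_int j)))))"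
    by (intro infsum_int_mono on_unit)
  also have "\<dots> < \<infinity>"
    using assms by (simp add: wiener_space_def)
  finally have L1: "(\<integral>\<^sup>+t. ennreal (cmod (g t)) \<partial>lebesgue) < \<infinity>" .
  have "AE t in lebesgue. ennreal (cmod (g t)) \<le> E"
    unfolding E_def by (rule esssup_AE)
  then have "(\<integral>\<^sup>+t. ennreal ((cmod (g t))\<^sup>2) \<partial>lebesgue) \<le> (\<integral>\<^sup>+t. E * ennreal (cmod (g t)) \<partial>lebesgue)"
    by (intro nn_integral_mono_AE)
      (auto elim!: eventually_mono simp: power2_eq_square ennreal_mult intro!: mult_right_mono)
  also have "\<dots> = E * (\<integral>\<^sup>+t. ennreal (cmod (g t)) \<partial>lebesgue)"
    by (rule nn_integral_cmult) measurable
  also have "\<dots> < \<infinity>"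
    using E L1 by (simp add: ennreal_mult_less_top)
  finally show ?thesis
    unfolding sq_integrable_def by (auto intro!: integrableI_bounded)
qed

lemma nsg_system_pos: "nsg_system g b \<Longrightarrow> 0 < b k"
  unfolding nsg_system_def by (meson atLeastAtMost_iff less_le_trans)

lemma nsg_system_sq_integrable: "nsg_system g b \<Longrightarrow> sq_integrable (g k)"
  by (simp add: nsg_system_def wiener_space_sq_integrable)

lemma nsg_family_diff:
  assumes "\<And>k. sq_integrable (g k)" "\<And>k. sq_integrable (h k)"
  shows "nsg_family (\<lambda>k t. h k t - g k t) b = (\<lambda>i. nsg_family h b i - nsg_family g b i)"
proof -
  have "modulation \<omega> (\<lambda>t. h k t - g k t) = (\<lambda>t. modulation \<omega> (h k) t - modulation \<omega> (g k) t)" for \<omega> k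
    by (simp add: fun_eq_iff modulation_def algebra_simps)
  then show ?thesis
    by (simp add: fun_eq_iff [of "nsg_family _ _"] nsg_family_def minus_abs_L2
        sq_integrable_modulation assms)
qed

text \<open>Being strictly below \<open>ennreal D\<close>, the essential supremum is finite and
  itself provides the real bound \<open>C\<close>; the strict gap is what later makes the operator
  norm strictly less than 1.\<close>

lemma nsg_family_bessel_less:
  assumes "\<And>k. sq_integrable (\<psi> k)" "\<And>k. 0 < b k"
    and D: "esssup lebesgue (\<lambda>t. \<Sum>\<^sub>\<infinity>l. G_corr \<psi> b l t) < ennreal D"
  obtains C where "0 \<le> C" "C < D" "bessel_sequence (nsg_family \<psi> b) C"
proof -
  obtain C where C: "0 \<le> C" "esssup lebesgue (\<lambda>t. \<Sum>\<^sub>\<infinity>l. G_corr \<psi> b l t) = ennreal C"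
    using D by (metis ennreal_cases not_less_iff_gr_or_eq order.strict_trans ennreal_less_top)
  show thesis
  proof (rule that)
    show "C < D"
      using C D by (simp add: ennreal_less_iff)
    show "bessel_sequence (nsg_family \<psi> b) C"
      using esssup_AE [of "\<lambda>t. \<Sum>\<^sub>\<infinity>l. G_corr \<psi> b l t" lebesgue]
      by (intro bessel_sequence_nsg_family assms(1,2) C(1)) (simp add: C(2))
  qed (rule C)
qed

theorem proposition4p2:
  fixes g h \<psi> :: "int \<Rightarrow> real \<Rightarrow> complex" and b :: "int \<Rightarrow> real"
    and B A\<^sub>h B\<^sub>h :: real and \<gamma>1 \<gamma>2 :: "int \<times> int \<Rightarrow> L2"
  assumes "nsg_system g b" and "bessel_sequence (nsg_family g b) B"
    and "nsg_system h b" and "frame (nsg_family h b) A\<^sub>h B\<^sub>h"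
    and "\<psi> = (\<lambda>k t. h k t - g k t)"
    and "\<gamma>1 = (\<lambda>i. inv (mixed_op (nsg_family h b) (nsg_family h b)) (nsg_family h b i))"
    and "\<gamma>2 = (\<lambda>i. inv (mixed_op (nsg_family h b) (nsg_family h b)) (nsg_family g b i))"
  shows
    "(onorm (\<lambda>f. f - mixed_op (nsg_family g b) \<gamma>1 f)
        \<le> A\<^sub>h powr (- 1 / 2) * analysis_onorm (nsg_family \<psi> b)
      \<and> (esssup lebesgue (\<lambda>t. \<Sum>\<^sub>\<infinity>l. G_corr \<psi> b l t) < ennreal A\<^sub>h
          \<longrightarrow> approx_dual_frames \<gamma>1 (nsg_family g b)))
     \<and>
     (onorm (\<lambda>f. f - mixed_op (nsg_family g b) \<gamma>2 f)
        \<le> inverse A\<^sub>h * (sqrt B\<^sub>h + sqrt B) * analysis_onorm (nsg_family \<psi> b)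
      \<and> (esssup lebesgue (\<lambda>t. \<Sum>\<^sub>\<infinity>l. G_corr \<psi> b l t)
            < ennreal (A\<^sub>h\<^sup>2 / (sqrt B\<^sub>h + sqrt B)\<^sup>2)
          \<longrightarrow> approx_dual_frames \<gamma>2 (nsg_family g b)))"
proof -
  let ?g = "nsg_family g b" and ?h = "nsg_family h b"
  let ?s = "sqrt B\<^sub>h + sqrt B"
  note g = assms(2) and h = assms(4)
  have \<psi>: "nsg_family \<psi> b = (\<lambda>i. ?h i - ?g i)"
    unfolding assms(5)
    by (intro nsg_family_diff nsg_system_sq_integrable [OF assms(1)]
        nsg_system_sq_integrable [OF assms(3)])
  have sq: "sq_integrable (\<psi> k)" for k
    unfolding assms(5)
    by (intro sq_integrable_diff nsg_system_sq_integrable [OF assms(1)]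
        nsg_system_sq_integrable [OF assms(3)])
  \<comment> \<open>\<open>?s\<close> is a denominator in (ii); it is positive because the upper
    frame bound dominates the positive lower one.\<close>
  have A: "0 < A\<^sub>h" and s: "0 < ?s"
    using frame_lower_pos [OF h] frame_bounds_le [OF h] bessel_sequence_nonneg [OF g]
    by (auto intro: add_pos_nonneg)
  have bound1: "onorm (\<lambda>f. f - mixed_op ?g \<gamma>1 f) \<le> A\<^sub>h powr (- 1 / 2) * analysis_onorm (nsg_family \<psi> b)"
    unfolding \<psi> assms(6) by (rule onorm_id_minus_mixed_op_canonical_dual [OF h g])
  have bound2: "onorm (\<lambda>f. f - mixed_op ?g \<gamma>2 f) \<le> inverse A\<^sub>h * ?s * analysis_onorm (nsg_family \<psi> b)"
    unfolding \<psi> assms(7) by (rule onorm_id_minus_mixed_op_inv [OF h g])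
  have dual1: "approx_dual_frames \<gamma>1 ?g"
    if less: "esssup lebesgue (\<lambda>t. \<Sum>\<^sub>\<infinity>l. G_corr \<psi> b l t) < ennreal A\<^sub>h"
  proof -
    obtain C where C: "0 \<le> C" "C < A\<^sub>h" "bessel_sequence (nsg_family \<psi> b) C"
      using nsg_family_bessel_less [OF sq nsg_system_pos [OF assms(1)] less] by blast
    note bound1
    also have "A\<^sub>h powr (- 1 / 2) * analysis_onorm (nsg_family \<psi> b) \<le> A\<^sub>h powr (- 1 / 2) * sqrt C"
      by (intro mult_left_mono bessel_analysis_onorm_upper C(3)) simp
    also have "\<dots> < A\<^sub>h powr (- 1 / 2) * sqrt A\<^sub>h"
      using A C by simp
    also have "\<dots> = 1"
      using A by (simp add: powr_half_sqrt [symmetric] flip: powr_add)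
    \<comment> \<open>This is the second alternative in \<open>approx_dual_frames\<close>:
      \<open>mixed_op\<close> analyses with the Gabor system and synthesizes with the dual
      family.\<close>
    finally have "onorm (\<lambda>f. f - mixed_op ?g \<gamma>1 f) < 1" .
    moreover have "bessel_sequence \<gamma>1 (inverse A\<^sub>h)"
      unfolding assms(6) by (rule bessel_canonical_dual [OF h])
    ultimately show ?thesis
      using g unfolding approx_dual_frames_def by blast
  qed
  have dual2: "approx_dual_frames \<gamma>2 ?g"
    if less: "esssup lebesgue (\<lambda>t. \<Sum>\<^sub>\<infinity>l. G_corr \<psi> b l t) < ennreal (A\<^sub>h\<^sup>2 / ?s\<^sup>2)"
  proof -
    obtain C where C: "0 \<le> C" "C < A\<^sub>h\<^sup>2 / ?s\<^sup>2" "bessel_sequence (nsg_family \<psi> b) C"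
      using nsg_family_bessel_less [OF sq nsg_system_pos [OF assms(1)] less] by blast
    \<comment> \<open>The root of the threshold is the reciprocal of the factor in
      \<open>bound2\<close>.\<close>
    have "sqrt C < sqrt ((A\<^sub>h / ?s)\<^sup>2)"
      using C(2) by (simp only: real_sqrt_less_iff power_divide)
    then have sqrt_C: "sqrt C < A\<^sub>h / ?s"
      using A s by simp
    note bound2
    also have "inverse A\<^sub>h * ?s * analysis_onorm (nsg_family \<psi> b) \<le> inverse A\<^sub>h * ?s * sqrt C"
      using A s by (intro mult_left_mono bessel_analysis_onorm_upper C(3)) simp
    also have "\<dots> < inverse A\<^sub>h * ?s * (A\<^sub>h / ?s)"
      using A s by (intro mult_strict_left_mono sqrt_C) simp
    also have "\<dots> = 1"
      using A s by simp
    finally have "onorm (\<lambda>f. f - mixed_op ?g \<gamma>2 f) < 1" .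
    moreover have "bessel_sequence \<gamma>2 (B * (inverse A\<^sub>h)\<^sup>2)"
      unfolding assms(7) by (rule bessel_inv_frame_op [OF h g])
    ultimately show ?thesis
      using g unfolding approx_dual_frames_def by blast
  qed
  show ?thesis
    using bound1 bound2 dual1 dual2 by blast
qed

end
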